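(* Let $G=A_n$ or $S_n$ with $n\geqslant 10$ and let $F$ be a field of characteristic $p\geqslant 0$. Let $1\leqslant k<\frac{n}{2}$ and let $\Omega_k$ be the set of all $k$-subsets of $\{1,2,\ldots,n\}$ with the natural action of $G$. Then $$\mathrm{LinDim}_F(G,\Omega_k)=\begin{cases} n-2 & \text{if } p\mid n \text{ and } p\mid k,\\ n-1 & \text{otherwise.}\end{cases}$$
   Context: A representation over $F$ of an action of a group $G$ on a set $\Omega$ is a pair $(\rho,\varphi)$ where, for some $F$-vector space $V$, $\rho:G\to \mathrm{GL}(V)$ is a homomorphism and $\varphi:\Omega\to V$ is injective with $(\omega^g)\varphi=(\omega\varphi)^{g\rho}$ for all $\omega\in\Omega$, $g\in G$ (maps written on the right). $\mathrm{LinDim}_F(G,\Omega)$ is the minimum of $\dim V$ over all $V$ affording such a representation. When $p=0$, $p$ divides neither $n$ nor $k$. *)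

theory Defs
  imports
    "HOL-Algebra.Sym_Groups"
    "HOL-Algebra.Bij"
    "HOL-Computational_Algebra.Computational_Algebra"
    "HOL-Library.Extended_Nat"
    "HOL-Library.Function_Algebras"
begin

definition general_linear ::
    "('f::field \<Rightarrow> 'v::ab_group_add \<Rightarrow> 'v) \<Rightarrow> 'v set \<Rightarrow> ('v \<Rightarrow> 'v) monoid"
  where "general_linear scale V = (BijGroup V)
    \<lparr> carrier := {T \<in> carrier (BijGroup V).
        (\<forall>x\<in>V. \<forall>y\<in>V. T (x + y) = T x + T y) \<and>
        (\<forall>c. \<forall>x\<in>V. T (scale c x) = scale c (T x))} \<rparr>"

text \<open>Here \<^term>\<open>V\<close> is the representation space, a subspace of an ambient vector space. All maps,
  including \<^term>\<open>act\<close> and the elements of the general linear group, are written on the left.\<close>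

definition linear_rep ::
    "('f::field \<Rightarrow> 'v::ab_group_add \<Rightarrow> 'v) \<Rightarrow> 'v set \<Rightarrow> ('g, 'm) monoid_scheme \<Rightarrow>
     ('g \<Rightarrow> 'w \<Rightarrow> 'w) \<Rightarrow> 'w set \<Rightarrow> ('g \<Rightarrow> 'v \<Rightarrow> 'v) \<Rightarrow> ('w \<Rightarrow> 'v) \<Rightarrow> bool"
  where "linear_rep scale V G act \<Omega> \<rho> \<phi> \<longleftrightarrow>
    module.subspace scale V \<and>
    \<rho> \<in> hom G (general_linear scale V) \<and>
    \<phi> \<in> \<Omega> \<rightarrow> V \<and> inj_on \<phi> \<Omega> \<and>
    (\<forall>g\<in>carrier G. \<forall>\<omega>\<in>\<Omega>. \<phi> (act g \<omega>) = \<rho> g (\<phi> \<omega>))"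

text \<open>The library's \<^term>\<open>vector_space.dim\<close> is only meaningful for finite-dimensional spaces.\<close>

definition edim :: "('f::field \<Rightarrow> 'v::ab_group_add \<Rightarrow> 'v) \<Rightarrow> 'v set \<Rightarrow> enat"
  where "edim scale V =
    (if \<exists>B. finite B \<and> module.span scale B = V then enat (vector_space.dim scale V) else \<infinity>)"

definition fun_scale :: "'f::field \<Rightarrow> (nat \<Rightarrow> 'f) \<Rightarrow> nat \<Rightarrow> 'f"
  where "fun_scale c v = (\<lambda>i. c * v i)"

lemma vector_space_fun_scale: "vector_space (fun_scale :: 'f::field \<Rightarrow> _)"
  by unfold_locales (auto simp: fun_scale_def fun_eq_iff algebra_simps)

text \<open>A definition cannot quantify over all types of vectors, so the representation spaces are
  taken among the subspaces of the space of all sequences over the field. This loses nothing: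
  by \<open>LinDim_le\<close> below, the value is a lower bound for the dimension of every representation
  space in every vector space over the same field. As \<^typ>\<open>enat\<close> is well-ordered, the infimum is
  a minimum; it is \<^term>\<open>\<infinity> :: enat\<close> iff there is no finite-dimensional representation.\<close>

definition LinDim ::
    "'f::field itself \<Rightarrow> ('g, 'm) monoid_scheme \<Rightarrow> ('g \<Rightarrow> 'w \<Rightarrow> 'w) \<Rightarrow> 'w set \<Rightarrow> enat"
  where "LinDim F G act \<Omega> =
    (INF V \<in> {V. \<exists>\<rho> \<phi>. linear_rep (fun_scale :: 'f \<Rightarrow> _) V G act \<Omega> \<rho> \<phi>}.
       edim (fun_scale :: 'f \<Rightarrow> _) V)"

text \<open>A representation can be transported along an injective linear map.\<close>

lemma linear_rep_transport:
  fixes scale :: "'f::field \<Rightarrow> 'v::ab_group_add \<Rightarrow> 'v"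
    and scale' :: "'f \<Rightarrow> 'u::ab_group_add \<Rightarrow> 'u"
  assumes f: "Vector_Spaces.linear scale scale' f" and inj: "inj_on f V"
    and rep: "linear_rep scale V G act \<Omega> \<rho> \<phi>"
  shows "\<exists>\<rho>' \<phi>'. linear_rep scale' (f ` V) G act \<Omega> \<rho>' \<phi>'"
proof -
  interpret f: Vector_Spaces.linear scale scale' f by (rule f)
  have sub: "f.vs1.subspace V" and hom: "\<rho> \<in> hom G (general_linear scale V)"
    and \<phi>: "\<phi> \<in> \<Omega> \<rightarrow> V" "inj_on \<phi> \<Omega>"
    and eqv: "\<And>g \<omega>. g \<in> carrier G \<Longrightarrow> \<omega> \<in> \<Omega> \<Longrightarrow> \<phi> (act g \<omega>) = \<rho> g (\<phi> \<omega>)"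
    using rep by (auto simp: linear_rep_def)
  define h where "h = the_inv_into V f"
  have hf [simp]: "h (f x) = x" if "x \<in> V" for x
    using that inj by (simp add: h_def the_inv_into_f_f)
  define \<rho>' where "\<rho>' g = (\<lambda>w\<in>f ` V. f (\<rho> g (h w)))" for g
  have \<rho>'_f [simp]: "\<rho>' g (f x) = f (\<rho> g x)" if "x \<in> V" for g x
    using that by (simp add: \<rho>'_def)
  have bij: "bij_betw (\<rho> g) V V" and ext: "\<rho> g \<in> Bij V"
    and lin: "x \<in> V \<Longrightarrow> y \<in> V \<Longrightarrow> \<rho> g (x + y) = \<rho> g x + \<rho> g y"
      "x \<in> V \<Longrightarrow> \<rho> g (scale c x) = scale c (\<rho> g x)"
    if "g \<in> carrier G" for g x y c
  proof -
    have "\<rho> g \<in> carrier (general_linear scale V)"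
      using hom that by (rule hom_in_carrier)
    then show "bij_betw (\<rho> g) V V" "\<rho> g \<in> Bij V"
      "x \<in> V \<Longrightarrow> y \<in> V \<Longrightarrow> \<rho> g (x + y) = \<rho> g x + \<rho> g y"
      "x \<in> V \<Longrightarrow> \<rho> g (scale c x) = scale c (\<rho> g x)"
      by (simp_all add: general_linear_def BijGroup_def Bij_def)
  qed
  have \<rho>V: "\<rho> g x \<in> V" if "g \<in> carrier G" "x \<in> V" for g x
    using bij[OF that(1)] that(2) by (auto simp: bij_betw_def)
  have bij': "bij_betw (\<rho>' g) (f ` V) (f ` V)" if g: "g \<in> carrier G" for g
    unfolding bij_betw_def
  proof
    show "inj_on (\<rho>' g) (f ` V)"
    proof (rule inj_onI)
      fix w w' assume "w \<in> f ` V" "w' \<in> f ` V" and eq: "\<rho>' g w = \<rho>' g w'"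
      then obtain x x' where x: "x \<in> V" "x' \<in> V" "w = f x" "w' = f x'" by auto
      have "\<rho> g x = \<rho> g x'"
        using eq x \<rho>V[OF g] inj_onD[OF inj] by simp
      then show "w = w'"
        using bij[OF g] x by (auto simp: bij_betw_def dest: inj_onD)
    qed
    have "\<rho>' g ` f ` V = f ` \<rho> g ` V"
      by (auto simp: image_image intro!: image_cong)
    then show "\<rho>' g ` f ` V = f ` V"
      using bij[OF g] by (simp add: bij_betw_def)
  qed
  have Bij': "\<rho>' g \<in> Bij (f ` V)" if "g \<in> carrier G" for g
    using bij'[OF that] by (simp add: Bij_def \<rho>'_def)
  have "\<rho>' \<in> hom G (general_linear scale' (f ` V))"
  proof (rule homI)
    fix g assume g: "g \<in> carrier G"
    show "\<rho>' g \<in> carrier (general_linear scale' (f ` V))"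
      using Bij'[OF g] sub g
      by (auto simp: general_linear_def BijGroup_def simp flip: f.add f.scale
          simp: f.vs1.subspace_add f.vs1.subspace_scale lin)
  next
    fix g1 g2 assume g: "g1 \<in> carrier G" "g2 \<in> carrier G"
    have "\<rho> (g1 \<otimes>\<^bsub>G\<^esub> g2) = compose V (\<rho> g1) (\<rho> g2)"
      using hom g ext by (simp add: hom_def general_linear_def BijGroup_def)
    then have "\<rho>' (g1 \<otimes>\<^bsub>G\<^esub> g2) = compose (f ` V) (\<rho>' g1) (\<rho>' g2)"
      using \<rho>V g by (auto simp: fun_eq_iff compose_def \<rho>'_def)
    then show "\<rho>' (g1 \<otimes>\<^bsub>G\<^esub> g2) = \<rho>' g1 \<otimes>\<^bsub>general_linear scale' (f ` V)\<^esub> \<rho>' g2"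
      using Bij' g by (simp add: general_linear_def BijGroup_def)
  qed
  moreover have "inj_on (f \<circ> \<phi>) \<Omega>"
    using \<phi> inj by (intro comp_inj_on) (auto intro: inj_on_subset)
  moreover have "(f \<circ> \<phi>) (act g \<omega>) = \<rho>' g ((f \<circ> \<phi>) \<omega>)" if "g \<in> carrier G" "\<omega> \<in> \<Omega>" for g \<omega>
    using \<phi> that by (simp add: eqv Pi_iff)
  ultimately have "linear_rep scale' (f ` V) G act \<Omega> \<rho>' (f \<circ> \<phi>)"
    using \<phi> sub by (auto simp: linear_rep_def f.subspace_image)
  then show ?thesis by blast
qed

lemma LinDim_le:
  fixes scale :: "'f::field \<Rightarrow> 'v::ab_group_add \<Rightarrow> 'v"
  assumes vs: "vector_space scale" and rep: "linear_rep scale V G act \<Omega> \<rho> \<phi>"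
  shows "LinDim TYPE('f) G act \<Omega> \<le> edim scale V"
proof (cases "\<exists>B. finite B \<and> module.span scale B = V")
  case False
  then have "edim scale V = \<infinity>" unfolding edim_def by (rule if_not_P)
  then show ?thesis by simp
next
  case True
  interpret vector_space_pair scale "fun_scale :: 'f \<Rightarrow> (nat \<Rightarrow> 'f) \<Rightarrow> _"
    using vs vector_space_fun_scale by (rule vector_space_pair.intro)
  obtain S where S: "finite S" "vs1.span S = V" using True by blast
  obtain B where B: "B \<subseteq> S" "vs1.independent B" "S \<subseteq> vs1.span B"
    using vs1.maximal_independent_subset[of S] by blast
  have fin: "finite B" using B(1) S(1) finite_subset by blast
  have span: "vs1.span B = V"
    using vs1.span_mono[OF B(1)] vs1.span_minimal[OF B(3) vs1.subspace_span] S(2) by simp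
  obtain e :: "'v \<Rightarrow> nat" where e: "inj_on e B"
    using finite_imp_inj_to_nat_seg[OF fin] by metis
  define u :: "'v \<Rightarrow> nat \<Rightarrow> 'f" where "u b = (\<lambda>i. if i = e b then 1 else 0)" for b
  define f where "f = construct B u"
  have f: "Vector_Spaces.linear scale fun_scale f"
    unfolding f_def using B(2) by (rule linear_construct)
  have fB: "f b = u b" if "b \<in> B" for b
    using that B(2) by (simp add: f_def construct_basis)
  have "inj_on u B"
  proof (rule inj_onI)
    fix b b' assume b: "b \<in> B" "b' \<in> B" "u b = u b'"
    from fun_cong[OF b(3), of "e b"] have "e b = e b'" by (simp add: u_def split: if_splits)
    with b e show "b = b'" by (auto dest: inj_onD)
  qed
  then have injB: "inj_on f B" using fB by (simp cong: inj_on_cong)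
  have indep: "vs2.independent (f ` B)"
  proof (rule vs2.independent_if_scalars_zero)
    fix c x assume sum: "(\<Sum>x\<in>f ` B. fun_scale (c x) x) = 0" and "x \<in> f ` B"
    then obtain b where b: "b \<in> B" "x = f b" by blast
    have apply_sum: "(\<Sum>a\<in>A. g a) i = (\<Sum>a\<in>A. g a i)"
      for A :: "'v set" and g :: "'v \<Rightarrow> nat \<Rightarrow> 'f" and i
      by (induction A rule: infinite_finite_induct) auto
    have "0 = (\<Sum>a\<in>B. fun_scale (c (f a)) (f a)) (e b)"
      using sum by (simp add: sum.reindex[OF injB])
    also have "\<dots> = (\<Sum>a\<in>B. if a = b then c (f a) else 0)"
      unfolding apply_sum using e b
      by (intro sum.cong) (auto simp: fun_scale_def fB u_def dest: inj_onD)
    also have "\<dots> = c x" using fin b by simp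
    finally show "c x = 0" by simp
  qed (use fin in simp)
  have inj: "inj_on f V"
    using linear_inj_on_span_independent_image[OF f indep injB] span by simp
  have im: "vs2.span (f ` B) = f ` V"
    using linear_span_image[OF f] span by simp
  have "edim scale V = enat (card B)"
    using True B(2) span by (auto simp: edim_def vs1.dim_eq_card_independent)
  moreover have "edim (fun_scale :: 'f \<Rightarrow> _) (f ` V) = enat (card B)"
  proof -
    have "vs2.dim (f ` V) = card B"
      using vs2.dim_span_eq_card_independent[OF indep] im card_image[OF injB] by simp
    then show ?thesis using im fin by (auto simp: edim_def)
  qed
  moreover have "LinDim TYPE('f) G act \<Omega> \<le> edim (fun_scale :: 'f \<Rightarrow> _) (f ` V)"
    unfolding LinDim_def using linear_rep_transport[OF f inj rep] by (intro INF_lower) simp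
  ultimately show ?thesis by simp
qed

end

theory Submission
  imports Defs
begin

text \<open>
  Upper bound. Send a k-subset to its indicator vector in the permutation module \<open>F^n\<close> modulo the
  constant vectors, a space of dimension \<open>n - 1\<close>. Since \<open>2 * k < n\<close>, different k-subsets have different
  images. If the characteristic divides \<open>n\<close> and \<open>k\<close>, then the constant vectors and the indicators
  all have coordinate sum 0, and the vectors of sum 0 modulo the constants form a representation of
  dimension \<open>n - 2\<close> (\<open>natural_rep\<close>, \<open>natural_space_edim_le\<close>).

  Lower bound. Given a representation on a space \<open>V\<close>, the coordinates of the vectors \<open>\<phi> A\<close> are functions
  of the k-subset \<open>A\<close>. They span a space \<open>U\<close> of functions whose dimension is at most that of \<open>V\<close>, which
  is invariant under the alternating group and contains a nonconstant function
  (\<open>linear_rep_ksets_edim_ge\<close>). The dimension of \<open>U\<close> is bounded by differencing its members along disjoint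
  transpositions, that is, by applying \<open>1 - t\<close>. There are two cases.

  Suppose that no function in \<open>U\<close> survives two such differences. Then \<open>U\<close> consists of affine functions of
  the coordinates \<open>[i \<in> A]\<close>, and as it is invariant and not constant, it contains every difference
  \<open>[i \<in> A] - [j \<in> A]\<close> (\<open>rigid_contains_coordinate_differences\<close>). These span a space of dimension \<open>n - 1\<close>,
  except if the sum over \<open>i\<close> of all \<open>[i \<in> A] - [n \<in> A]\<close>, which has the value \<open>k\<close> or \<open>k - n\<close>, is zero in the
  field; then there is one relation, and the dimension is \<open>n - 2\<close> (\<open>coordinate_differences_dimension\<close>).

  Suppose that some function survives differences along two disjoint transpositions. Take a nonzero
  result of differences along as many disjoint transpositions as possible, say \<open>d\<close>. By maximality it is
  invariant under the transpositions of the remaining points, hence it is nonzero exactly at those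
  k-subsets that contain one point of each of the \<open>d\<close> transposed pairs. Its translates are
  images of the polytabloids of the Specht module of \<open>(n - d, d)\<close> with \<open>d \<ge> 2\<close>; a triangular family of
  them shows that the dimension is at least \<open>2 * n - 3\<close> (\<open>alternating_two_pairs_dimension\<close>). Single transpositions
  are odd, so all this takes place in the closure of \<open>U\<close> under the symmetric group, whose dimension is at
  most twice that of \<open>U\<close>. Hence \<open>U\<close> has dimension at least \<open>n - 1\<close>.
\<close>

section \<open>Functions on a set, and functions on the k-subsets\<close>

definition pscale :: "'f::field \<Rightarrow> ('a \<Rightarrow> 'f) \<Rightarrow> 'a \<Rightarrow> 'f"
  where "pscale c u = (\<lambda>a. c * u a)"

global_interpretation fn: vector_space "pscale :: 'f::field \<Rightarrow> ('a \<Rightarrow> 'f) \<Rightarrow> 'a \<Rightarrow> 'f"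
  by unfold_locales (auto simp: pscale_def fun_eq_iff algebra_simps)

lemma sum_fun_apply: "(\<Sum>i\<in>I. u i) a = (\<Sum>i\<in>I. u i a)"
  for u :: "'i \<Rightarrow> 'a \<Rightarrow> 'f::field"
  by (induction I rule: infinite_finite_induct) auto

lemma independent_family_card_le:
  fixes u :: "'i \<Rightarrow> 'a \<Rightarrow> 'f::field"
  assumes I: "finite I" and T: "finite T" and u: "\<And>i. i \<in> I \<Longrightarrow> u i \<in> fn.span T"
    and indep: "\<And>c i. (\<And>a. (\<Sum>i\<in>I. c i * u i a) = 0) \<Longrightarrow> i \<in> I \<Longrightarrow> c i = 0"
  shows "card I \<le> card T"
proof -
  have inj: "inj_on u I"
  proof (rule inj_onI, rule ccontr)
    fix i j assume ij: "i \<in> I" "j \<in> I" "u i = u j" "i \<noteq> j"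
    \<comment> \<open>a repeated member would give the relation \<open>u i - u j = 0\<close>\<close>
    define c :: "'i \<Rightarrow> 'f" where "c = (\<lambda>l. if l = i then 1 else if l = j then -1 else 0)"
    have "(\<Sum>l\<in>I. c l * u l a) = 0" for a
    proof -
      have "(\<Sum>l\<in>I. c l * u l a) = (\<Sum>l\<in>{i,j}. c l * u l a)"
        using I ij by (intro sum.mono_neutral_right) (auto simp: c_def)
      then show ?thesis using ij by (simp add: c_def)
    qed
    from indep[of c i, OF this] ij(1) show False by (simp add: c_def)
  qed
  have "fn.independent (u ` I)"
  proof (rule fn.independent_if_scalars_zero)
    fix f x assume sum: "(\<Sum>x\<in>u ` I. pscale (f x) x) = 0" and "x \<in> u ` I"
    then obtain i where i: "i \<in> I" "x = u i" by blast
    have "(\<Sum>i\<in>I. f (u i) * u i a) = 0" for a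
      using fun_cong[OF sum, of a] by (simp add: sum.reindex[OF inj] sum_fun_apply pscale_def)
    from indep[of "\<lambda>i. f (u i)", OF this] i show "f x = 0" by simp
  qed (use I in simp)
  then have "card (u ` I) \<le> card T"
    using fn.independent_span_bound[OF T] u by blast
  then show ?thesis by (simp add: card_image[OF inj])
qed

text \<open>Evaluation at the points \<^term>\<open>p i\<close> gives a matrix with nonzero diagonal that becomes triangular
  after sorting the indices by \<^term>\<open>r\<close>; in a vanishing combination the coefficients therefore vanish
  one after the other, in the order of increasing \<^term>\<open>r\<close>.\<close>

lemma triangular_family_card_le:
  fixes u :: "'i \<Rightarrow> 'a \<Rightarrow> 'f::field" and r :: "'i \<Rightarrow> nat"
  assumes I: "finite I" and T: "finite T" and u: "\<And>i. i \<in> I \<Longrightarrow> u i \<in> fn.span T"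
    and diag: "\<And>i. i \<in> I \<Longrightarrow> u i (p i) \<noteq> 0"
    and tri: "\<And>i j. i \<in> I \<Longrightarrow> j \<in> I \<Longrightarrow> i \<noteq> j \<Longrightarrow> u i (p j) \<noteq> 0 \<Longrightarrow> r i < r j"
  shows "card I \<le> card T"
proof (rule independent_family_card_le[OF I T u])
  fix c and i
  assume sum: "\<And>a. (\<Sum>i\<in>I. c i * u i a) = 0" and "i \<in> I"
  then show "c i = 0"
  proof (induction "r i" arbitrary: i rule: less_induct)
    case less
    have "0 = (\<Sum>j\<in>I. c j * u j (p i))" using sum by simp
    also have "\<dots> = (\<Sum>j\<in>{i}. c j * u j (p i))"
      using less I tri by (intro sum.mono_neutral_right) auto
    finally show ?case using diag less.prems by simp
  qed
qed auto

definition ksets :: "nat \<Rightarrow> nat \<Rightarrow> nat set set"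
  where "ksets n k = {A. A \<subseteq> {1..n} \<and> card A = k}"

definition shift :: "(nat \<Rightarrow> nat) \<Rightarrow> (nat set \<Rightarrow> 'f) \<Rightarrow> nat set \<Rightarrow> 'f"
  where "shift g u = (\<lambda>A. u (g ` A))"

lemma shift_shift: "shift g (shift h u) = shift (h \<circ> g) u"
  by (simp add: shift_def image_comp)

lemma shift_id [simp]: "shift id u = u"
  by (simp add: shift_def)

lemma shift_span:
  fixes T :: "(nat set \<Rightarrow> 'f::field) set"
  assumes "u \<in> fn.span T"
  shows "shift g u \<in> fn.span (shift g ` T)"
  using assms
proof (induction rule: fn.span_induct_alt)
  case base
  have "shift g (0 :: nat set \<Rightarrow> 'f) = 0" by (simp add: shift_def fun_eq_iff)
  then show ?case by (simp only: fn.span_zero)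
next
  case (step c x y)
  have eq: "shift g (pscale c x + y) = pscale c (shift g x) + shift g y"
    by (simp add: shift_def pscale_def fun_eq_iff)
  show ?case unfolding eq by (intro fn.span_add fn.span_scale fn.span_base imageI step)
qed

lemma ksets_image_iff: "g ` A \<in> ksets n k \<longleftrightarrow> A \<in> ksets n k" if "g permutes {1..n}"
proof -
  have "g ` A \<subseteq> {1..n} \<longleftrightarrow> A \<subseteq> {1..n}"
    using permutes_in_image[OF that] by blast
  then show ?thesis by (simp add: ksets_def card_image[OF permutes_inj_on[OF that]])
qed

lemma finite_ksets [simp]: "finite (ksets n k)"
  unfolding ksets_def by (rule finite_subset[of _ "Pow {1..n}"]) auto

lemma ksetsD: "A \<in> ksets n k \<Longrightarrow> A \<subseteq> {1..n}" "A \<in> ksets n k \<Longrightarrow> card A = k" "A \<in> ksets n k \<Longrightarrow> finite A"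
  unfolding ksets_def by (auto intro: finite_subset)

section \<open>Matchings and the sets that split them\<close>

text \<open>A matching consists of the disjoint pairs of points \<open>{x, \<beta> x}\<close> with \<^term>\<open>x \<in> X\<close>. These pairs are
  the supports of the commuting transpositions by which functions get differenced below.\<close>

definition matching :: "nat \<Rightarrow> nat set \<Rightarrow> (nat \<Rightarrow> nat) \<Rightarrow> bool"
  where "matching n X \<beta> \<longleftrightarrow> X \<subseteq> {1..n} \<and> \<beta> ` X \<subseteq> {1..n} \<and> inj_on \<beta> X \<and> X \<inter> \<beta> ` X = {}"

definition splits :: "nat set \<Rightarrow> (nat \<Rightarrow> nat) \<Rightarrow> nat set \<Rightarrow> bool"
  where "splits X \<beta> A \<longleftrightarrow> (\<forall>x\<in>X. x \<in> A \<longleftrightarrow> \<beta> x \<notin> A)"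

lemma transpose_image_fixed: "transpose a b ` A = A" if "a \<in> A \<longleftrightarrow> b \<in> A"
  using that by (auto simp: in_transpose_image_iff Transposition.transpose_def split: if_splits)

lemma transpose_image_exchange: "transpose a b ` A = insert b (A - {a})" if "a \<in> A" "b \<notin> A"
  using that by (auto simp: in_transpose_image_iff Transposition.transpose_def split: if_splits)

lemma splits_transpose_outside:
  assumes "a \<notin> X \<union> \<beta> ` X" "b \<notin> X \<union> \<beta> ` X"
  shows "splits X \<beta> (transpose a b ` A) \<longleftrightarrow> splits X \<beta> A"
  unfolding splits_def using assms by (intro ball_cong) (auto simp: in_transpose_image_iff Transposition.transpose_def split: if_splits)

lemma splits_transpose_pair:
  assumes M: "matching n X \<beta>" and x: "x \<in> X"
  shows "splits X \<beta> (transpose x (\<beta> x) ` A) \<longleftrightarrow> splits X \<beta> A"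
  unfolding splits_def
proof (intro ball_cong refl)
  fix y assume y: "y \<in> X"
  have "y \<noteq> \<beta> x" "\<beta> y \<noteq> x" using M x y by (auto simp: matching_def)
  moreover have "\<beta> y = \<beta> x \<longleftrightarrow> y = x" using M x y by (auto simp: matching_def dest: inj_onD)
  ultimately show "(y \<in> transpose x (\<beta> x) ` A \<longleftrightarrow> \<beta> y \<notin> transpose x (\<beta> x) ` A) \<longleftrightarrow> (y \<in> A \<longleftrightarrow> \<beta> y \<notin> A)"
    by (auto simp: in_transpose_image_iff Transposition.transpose_def split: if_splits)
qed

text \<open>The k-subsets that split a matching form one orbit under the transpositions of the matched pairs
  and the transpositions of unmatched points, so that a property which these moves preserve spreads
  to all of them. Indeed, if \<^term>\<open>A\<close> and \<^term>\<open>A'\<close> differ inside a pair, then flipping it brings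
  \<^term>\<open>A\<close> closer to \<^term>\<open>A'\<close>; otherwise they differ at unmatched points only, one of which can be
  exchanged. With an empty matching this is the connectedness of the Johnson graph.\<close>

lemma splits_connected:
  assumes M: "matching n X \<beta>"
    and A: "A \<in> ksets n k" "splits X \<beta> A" "P A"
    and A': "A' \<in> ksets n k" "splits X \<beta> A'"
    and swap: "\<And>B a b. B \<in> ksets n k \<Longrightarrow> splits X \<beta> B \<Longrightarrow> P B \<Longrightarrow> a \<in> {1..n} - (X \<union> \<beta> ` X) \<Longrightarrow>
      b \<in> {1..n} - (X \<union> \<beta> ` X) \<Longrightarrow> a \<noteq> b \<Longrightarrow> P (transpose a b ` B)"
    and flip: "\<And>B x. B \<in> ksets n k \<Longrightarrow> splits X \<beta> B \<Longrightarrow> P B \<Longrightarrow> x \<in> X \<Longrightarrow> P (transpose x (\<beta> x) ` B)"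
  shows "P A'"
  using A
proof (induction "card (A - A')" arbitrary: A rule: less_induct)
  case less
  note fin = ksetsD(3)[OF less.prems(1)] ksetsD(3)[OF A'(1)]
  have card: "card A = card A'" using ksetsD(2) less.prems(1) A'(1) by metis
  have closer: "card (insert b (A - {a}) - A') < card (A - A')" if "a \<in> A - A'" "b \<in> A'" for a b
    using that fin by (intro psubset_card_mono) auto
  show ?case
  proof (cases "A \<subseteq> A'")
    case True
    then have "A = A'" using card fin by (simp add: card_subset_eq)
    then show ?thesis using less.prems by simp
  next
    case False
    have "\<not> A' \<subseteq> A" using False card fin by (metis card_subset_eq order_refl)
    with False obtain a b where ab: "a \<in> A - A'" "b \<in> A' - A" by blast
    show ?thesis
    proof (cases "\<exists>x\<in>X. x \<in> A \<longleftrightarrow> x \<notin> A'")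
      case True
      then obtain x where x: "x \<in> X" "x \<in> A \<longleftrightarrow> x \<notin> A'" by blast
      let ?B = "transpose x (\<beta> x) ` A"
      have \<beta>x: "\<beta> x \<in> A \<longleftrightarrow> x \<notin> A" "\<beta> x \<in> A' \<longleftrightarrow> x \<notin> A'"
        using less.prems(2) A'(2) x(1) by (auto simp: splits_def)
      have "card (?B - A') < card (A - A')"
      proof (cases "x \<in> A")
        case True
        then show ?thesis using x \<beta>x closer[of x "\<beta> x"] by (simp add: transpose_image_exchange)
      next
        case False
        then show ?thesis using x \<beta>x closer[of "\<beta> x" x]
          by (simp add: transpose_image_exchange transpose_commute[of x])
      qed
      moreover have "x \<in> {1..n}" "\<beta> x \<in> {1..n}"
        using M x(1) unfolding matching_def by blast+
      then have "?B \<in> ksets n k"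
        using less.prems(1) by (simp add: ksets_image_iff[OF permutes_swap_id])
      ultimately show ?thesis
        using less.hyps[of ?B] flip[OF less.prems x(1)] splits_transpose_pair[OF M x(1)] less.prems(2)
        by blast
    next
      case False
      let ?B = "transpose a b ` A"
      have out: "a \<notin> X \<union> \<beta> ` X" "b \<notin> X \<union> \<beta> ` X"
        using False ab less.prems(2) A'(2) by (auto simp: splits_def)
      have in_n: "a \<in> {1..n}" "b \<in> {1..n}"
        using ab ksetsD(1) less.prems(1) A'(1) by blast+
      have "card (?B - A') < card (A - A')"
        using ab closer[of a b] by (simp add: transpose_image_exchange)
      moreover have "?B \<in> ksets n k"
        using less.prems(1) by (simp add: ksets_image_iff[OF permutes_swap_id[OF in_n]])
      moreover have "a \<noteq> b" using ab by blast
      ultimately show ?thesis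
        using less.hyps[of ?B] swap[OF less.prems, of a b] splits_transpose_outside[OF out] less.prems(2) out in_n
        by blast
    qed
  qed
qed

lemma matching_card_le: "card X \<le> k" if "matching n X \<beta>" "A \<in> ksets n k" "splits X \<beta> A"
proof -
  have "inj_on (\<lambda>x. if x \<in> A then x else \<beta> x) X"
    using that(1) by (auto simp: inj_on_def matching_def)
  moreover have "(\<lambda>x. if x \<in> A then x else \<beta> x) ` X \<subseteq> A"
    using that(3) by (auto simp: splits_def)
  ultimately show ?thesis
    using card_inj_on_le[of _ X A] ksetsD[OF that(2)] by auto
qed

lemma matching_extend:
  assumes "matching n X \<beta>" "a \<in> {1..n} - (X \<union> \<beta> ` X)" "b \<in> {1..n} - (X \<union> \<beta> ` X)" "a \<noteq> b"
  shows "matching n (insert a X) (\<beta>(a := b))"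
  using assms by (auto simp: matching_def inj_on_def fun_upd_def)

lemma splits_extend:
  assumes "a \<notin> X"
  shows "splits (insert a X) (\<beta>(a := b)) A \<longleftrightarrow> (a \<in> A \<longleftrightarrow> b \<notin> A) \<and> splits X \<beta> A"
  using assms by (auto simp: splits_def)

lemma matchings_conjugate:
  assumes M: "matching n X \<beta>" "matching n X' \<beta>'" and card: "card X' = card X"
  obtains \<sigma> where "\<sigma> permutes {1..n}" "\<sigma> ` X' = X" "\<And>x. x \<in> X' \<Longrightarrow> \<sigma> (\<beta>' x) = \<beta> (\<sigma> x)"
proof -
  have fin: "finite X" "finite X'" using M by (auto simp: matching_def intro: finite_subset)
  obtain f where f: "bij_betw f X' X"
    using finite_same_card_bij[OF fin(2,1) card] by blast
  have inj: "inj_on \<beta> X" "inj_on \<beta>' X'" and disj: "X \<inter> \<beta> ` X = {}" "X' \<inter> \<beta>' ` X' = {}"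
    using M by (auto simp: matching_def)
  define P P' where "P = X \<union> \<beta> ` X" and "P' = X' \<union> \<beta>' ` X'"
  have P: "P \<subseteq> {1..n}" "P' \<subseteq> {1..n}" using M by (auto simp: P_def P'_def matching_def)
  \<comment> \<open>the partner of \<open>x\<close> has to go to the partner of the image of \<open>x\<close>; the other points go anywhere\<close>
  define h where "h = (\<lambda>y. \<beta> (f (the_inv_into X' \<beta>' y)))"
  have h: "h (\<beta>' x) = \<beta> (f x)" if "x \<in> X'" for x
    using that inj by (simp add: h_def the_inv_into_f_f)
  have "bij_betw h (\<beta>' ` X') (\<beta> ` X)"
    unfolding h_def using f inj
    by (intro bij_betw_trans[OF bij_betw_the_inv_into bij_betw_trans[OF f], unfolded o_def])
       (auto simp: bij_betw_def)
  then have fh: "bij_betw (\<lambda>x. if x \<in> X' then f x else h x) P' P"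
    unfolding P_def P'_def using f disj by (intro bij_betw_disjoint_Un) auto
  have "card P' = card P" using bij_betw_same_card[OF fh] .
  then have "card ({1..n} - P') = card ({1..n} - P)"
    using P by (simp add: card_Diff_subset finite_subset[of _ "{1..n}"])
  then obtain r where r: "bij_betw r ({1..n} - P') ({1..n} - P)"
    using finite_same_card_bij[of "{1..n} - P'" "{1..n} - P"] by auto
  define s where "s x = (if x \<in> P' then if x \<in> X' then f x else h x else r x)" for x
  have "bij_betw s (P' \<union> ({1..n} - P')) (P \<union> ({1..n} - P))"
    unfolding s_def using fh r by (intro bij_betw_disjoint_Un) auto
  then have s: "bij_betw s {1..n} {1..n}"
    using P by (simp add: Un_absorb1)
  define \<sigma> where "\<sigma> x = (if x \<in> {1..n} then s x else x)" for x
  have "\<sigma> permutes {1..n}"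
  proof (rule bij_imp_permutes)
    show "bij_betw \<sigma> {1..n} {1..n}"
      using s by (subst bij_betw_cong[of _ _ s]) (auto simp: \<sigma>_def)
  qed (auto simp: \<sigma>_def)
  moreover have \<sigma>X: "\<sigma> x = f x" if "x \<in> X'" for x
    using that P by (auto simp: \<sigma>_def s_def P'_def)
  moreover have "\<sigma> ` X' = X"
    using f \<sigma>X by (simp add: bij_betw_def)
  moreover have "\<sigma> (\<beta>' x) = \<beta> (\<sigma> x)" if "x \<in> X'" for x
  proof -
    have "\<beta>' x \<in> P'" "\<beta>' x \<notin> X'" using that disj by (auto simp: P'_def)
    then have "\<sigma> (\<beta>' x) = h (\<beta>' x)"
      using P by (auto simp: \<sigma>_def s_def)
    then show ?thesis using h \<sigma>X that by simp
  qed
  ultimately show ?thesis using that by blast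
qed

section \<open>Alternating functions\<close>

text \<open>The model is \<open>h A = (\<Prod>x\<in>X. [x \<in> A] - [\<beta> x \<in> A])\<close>, the function given by a polytabloid of
  the Specht module of the partition \<open>(n - d, d)\<close>, where \<open>d\<close> is the number of pairs. That \<^term>\<open>h\<close>
  is supported on the sets that split the matching follows from the sign rule except in
  characteristic 2, and hence is part of the definition.\<close>

definition alternating :: "nat set \<Rightarrow> (nat \<Rightarrow> nat) \<Rightarrow> (nat set \<Rightarrow> 'f::field) \<Rightarrow> bool"
  where "alternating X \<beta> h \<longleftrightarrow> h \<noteq> 0 \<and> (\<forall>A. h A \<noteq> 0 \<longrightarrow> splits X \<beta> A) \<and>
    (\<forall>x\<in>X. \<forall>A. h (transpose x (\<beta> x) ` A) = - h A)"

lemma transpose_image_involutory [simp]: "transpose a b ` transpose a b ` A = A"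
  by (simp add: image_comp)

lemma transpose_image_commute:
  assumes "{a, b} \<inter> {c, d} = {}"
  shows "transpose a b ` transpose c d ` A = transpose c d ` transpose a b ` A"
proof -
  have "transpose a b \<circ> transpose c d = transpose c d \<circ> transpose a b"
    using assms by (auto simp: fun_eq_iff Transposition.transpose_def)
  then show ?thesis by (simp add: image_comp)
qed

text \<open>Differencing along a transposition of unmatched points adds its pair to the matching: the
  transposition commutes with those of the other pairs, and the difference vanishes at every set that
  the transposition fixes.\<close>

lemma alternating_extend:
  assumes M: "matching n X \<beta>" and h: "alternating X \<beta> h"
    and ab: "a \<in> {1..n} - (X \<union> \<beta> ` X)" "b \<in> {1..n} - (X \<union> \<beta> ` X)" "a \<noteq> b"
    and moved: "shift (transpose a b) h \<noteq> h"
  shows "alternating (insert a X) (\<beta>(a := b)) (h - shift (transpose a b) h)" (is "alternating _ _ ?h")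
  unfolding alternating_def
proof (intro conjI allI impI ballI)
  show "?h \<noteq> 0" using moved by auto
next
  fix A assume nz: "?h A \<noteq> 0"
  have "splits X \<beta> A"
  proof (cases "h A = 0")
    case True
    then have "h (transpose a b ` A) \<noteq> 0" using nz by (auto simp: shift_def)
    then have "splits X \<beta> (transpose a b ` A)" using h by (simp add: alternating_def)
    then show ?thesis using ab splits_transpose_outside by blast
  qed (use h in \<open>auto simp: alternating_def\<close>)
  moreover have "a \<in> A \<longleftrightarrow> b \<notin> A"
    using nz transpose_image_fixed[of a A b] by (cases "a \<in> A"; cases "b \<in> A") (auto simp: shift_def)
  ultimately show "splits (insert a X) (\<beta>(a := b)) A"
    using ab by (subst splits_extend) auto
next
  fix x A assume "x \<in> insert a X"
  then consider "x = a" | "x \<in> X" "x \<noteq> a" by blast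
  then show "?h (transpose x ((\<beta>(a := b)) x) ` A) = - ?h A"
  proof cases
    case 2
    have "{a, b} \<inter> {x, \<beta> x} = {}" using ab 2 by auto
    then have "h (transpose a b ` transpose x (\<beta> x) ` A) = h (transpose x (\<beta> x) ` transpose a b ` A)"
      by (rule arg_cong[OF transpose_image_commute])
    then show ?thesis using 2 h by (simp add: shift_def alternating_def)
  qed (simp add: shift_def)
qed

locale symmetric_functions =
  fixes n k :: nat and S :: "(nat set \<Rightarrow> 'f::field) set"
  assumes subspace: "fn.subspace S"
    and support: "\<And>u A. u \<in> S \<Longrightarrow> u A \<noteq> 0 \<Longrightarrow> A \<in> ksets n k"
    and shift_closed: "\<And>g u. g permutes {1..n} \<Longrightarrow> u \<in> S \<Longrightarrow> shift g u \<in> S"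
begin

text \<open>The moves of \<open>splits_connected\<close> change the values of such a function by a sign at most.\<close>

lemma shift_invariant_full_support:
  assumes M: "matching n X \<beta>" and h: "h \<in> S" "alternating X \<beta> h"
    and inv: "\<And>a b. a \<in> {1..n} - (X \<union> \<beta> ` X) \<Longrightarrow> b \<in> {1..n} - (X \<union> \<beta> ` X) \<Longrightarrow> a \<noteq> b \<Longrightarrow>
      shift (transpose a b) h = h"
  shows "h A \<noteq> 0 \<longleftrightarrow> A \<in> ksets n k \<and> splits X \<beta> A"
proof
  assume "h A \<noteq> 0"
  then show "A \<in> ksets n k \<and> splits X \<beta> A"
    using support[OF h(1)] h(2) by (simp add: alternating_def)
next
  assume A: "A \<in> ksets n k \<and> splits X \<beta> A"
  obtain A0 where A0: "h A0 \<noteq> 0" using h(2) by (force simp: alternating_def fun_eq_iff)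
  show "h A \<noteq> 0"
  proof (rule splits_connected[OF M, where P = "\<lambda>A. h A \<noteq> 0" and A = A0])
    show "A0 \<in> ksets n k" "splits X \<beta> A0"
      using A0 support[OF h(1)] h(2) by (auto simp: alternating_def)
    show "h (transpose a b ` B) \<noteq> 0" if "h B \<noteq> 0"
      "a \<in> {1..n} - (X \<union> \<beta> ` X)" "b \<in> {1..n} - (X \<union> \<beta> ` X)" "a \<noteq> b" for B a b
      using that(1) fun_cong[OF inv[OF that(2-4)], of B] by (simp add: shift_def)
    show "h (transpose x (\<beta> x) ` B) \<noteq> 0" if "h B \<noteq> 0" "x \<in> X" for B x
      using that h(2) by (simp add: alternating_def)
  qed (use A0 A in auto)
qed

text \<open>Keep adding pairs as long as some transposition of unmatched points moves the function. The
  process ends because there are only finitely many points.\<close>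

lemma maximal_alternating:
  assumes "matching n X \<beta>" "h \<in> S" "alternating X \<beta> h"
  obtains X' \<beta>' h' where "matching n X' \<beta>'" "h' \<in> S" "card X \<le> card X'"
    "\<And>A. h' A \<noteq> 0 \<longleftrightarrow> A \<in> ksets n k \<and> splits X' \<beta>' A" "h' \<noteq> 0"
proof -
  have "\<exists>X' \<beta>' h'. matching n X' \<beta>' \<and> h' \<in> S \<and> card X \<le> card X' \<and> h' \<noteq> 0 \<and>
    (\<forall>A. h' A \<noteq> 0 \<longleftrightarrow> A \<in> ksets n k \<and> splits X' \<beta>' A)"
    using assms
  proof (induction "n - card X" arbitrary: X \<beta> h rule: less_induct)
    case less
    have X: "X \<subseteq> {1..n}" using less.prems(1) by (auto simp: matching_def)
    show ?case
    proof (cases "\<exists>a b. a \<in> {1..n} - (X \<union> \<beta> ` X) \<and> b \<in> {1..n} - (X \<union> \<beta> ` X) \<and> a \<noteq> b \<and>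
        shift (transpose a b) h \<noteq> h")
      case False
      then have "h A \<noteq> 0 \<longleftrightarrow> A \<in> ksets n k \<and> splits X \<beta> A" for A
        using shift_invariant_full_support[OF less.prems] by blast
      moreover have "h \<noteq> 0" using less.prems(3) by (simp add: alternating_def)
      ultimately show ?thesis using less.prems(1,2) by blast
    next
      case True
      then obtain a b where ab: "a \<in> {1..n} - (X \<union> \<beta> ` X)" "b \<in> {1..n} - (X \<union> \<beta> ` X)" "a \<noteq> b"
        "shift (transpose a b) h \<noteq> h" by blast
      let ?h = "h - shift (transpose a b) h"
      have M: "matching n (insert a X) (\<beta>(a := b))"
        using matching_extend[OF less.prems(1) ab(1-3)] .
      have S: "?h \<in> S"
        using ab less.prems(2) by (intro fn.subspace_diff[OF subspace] shift_closed permutes_swap_id) auto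
      have fin: "finite X" using X finite_subset by blast
      have card: "card (insert a X) = Suc (card X)"
        using ab fin by simp
      moreover have "card (insert a X) \<le> n"
        using card_mono[of "{1..n}" "insert a X"] X ab by simp
      ultimately have "n - card (insert a X) < n - card X" by simp
      from less.hyps[OF this M S alternating_extend[OF less.prems(1,3) ab]] show ?thesis
        unfolding card by (meson Suc_leD)
    qed
  qed
  then show ?thesis using that by blast
qed

text \<open>All matchings of the same size are conjugate under the symmetric group, so one function with full
  support on the sets that split its matching has translates of the same kind for all of them.\<close>

lemma full_matching_functions:
  assumes "matching n X \<beta>" "h \<in> S" "alternating X \<beta> h"
  obtains d where "card X \<le> d" "d \<le> k"
    "\<And>X' \<beta>'. matching n X' \<beta>' \<Longrightarrow> card X' = d \<Longrightarrow>
      \<exists>u\<in>S. \<forall>A. u A \<noteq> 0 \<longleftrightarrow> A \<in> ksets n k \<and> splits X' \<beta>' A"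
proof -
  obtain Y \<gamma> h where Y: "matching n Y \<gamma>" "h \<in> S" "card X \<le> card Y"
    "\<And>A. h A \<noteq> 0 \<longleftrightarrow> A \<in> ksets n k \<and> splits Y \<gamma> A" "h \<noteq> 0"
    using maximal_alternating[OF assms] by metis
  show ?thesis
  proof (rule that[of "card Y"])
    obtain A where "h A \<noteq> 0" using Y(5) by (force simp: fun_eq_iff)
    then show "card Y \<le> k" using Y(4) matching_card_le[OF Y(1)] by blast
    fix X' \<beta>' assume M: "matching n X' \<beta>'" "card X' = card Y"
    obtain \<sigma> where \<sigma>: "\<sigma> permutes {1..n}" "\<sigma> ` X' = Y" "\<And>x. x \<in> X' \<Longrightarrow> \<sigma> (\<beta>' x) = \<gamma> (\<sigma> x)"
      using matchings_conjugate[OF Y(1) M] by blast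
    have "splits Y \<gamma> (\<sigma> ` A) \<longleftrightarrow> splits X' \<beta>' A" for A
      unfolding splits_def \<sigma>(2)[symmetric] ball_simps
      by (simp flip: \<sigma>(3) add: inj_image_mem_iff[OF permutes_inj[OF \<sigma>(1)]])
    then have "shift \<sigma> h A \<noteq> 0 \<longleftrightarrow> A \<in> ksets n k \<and> splits X' \<beta>' A" for A
      by (simp add: shift_def Y(4) ksets_image_iff[OF \<sigma>(1)])
    then show "\<exists>u\<in>S. \<forall>A. u A \<noteq> 0 \<longleftrightarrow> A \<in> ksets n k \<and> splits X' \<beta>' A"
      using shift_closed[OF \<sigma>(1) Y(2)] by blast
  qed (use Y in auto)
qed

end

section \<open>Two alternating pairs force a large dimension\<close>

lemma choose_ge_self: "m \<le> m choose r" if "1 \<le> r" "r < m" for m r :: nat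
  using that
proof (induction m arbitrary: r)
  case (Suc m)
  then obtain s where s: "r = Suc s" by (cases r) auto
  show ?case
  proof (cases "r < m")
    case True
    then have "m \<le> m choose Suc s" using Suc s by auto
    moreover have "1 \<le> m choose s" using True s by (simp add: Suc_le_eq)
    ultimately show ?thesis using s by simp
  next
    case False
    then have "r = m" using Suc.prems by simp
    then show ?thesis by (simp add: binomial_symmetric[of m "Suc m"])
  qed
qed simp

text \<open>The left-hand side is \<open>2 * n - 3\<close> in the extreme case \<open>n = 2 * N - 1\<close>, where \<open>N = n - k\<close>.
  The case \<open>d = 2\<close> is the tightest and needs both summands in full.\<close>

lemma two_row_count_ge:
  fixes N d :: nat
  assumes "6 \<le> N" "2 \<le> d" "d < N"
  shows "4 * N - 5 \<le> (N choose d) + (d - 1) * ((N - 1) choose (d - 1))"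
proof -
  consider "d = 2" | "d = 3" | "4 \<le> d" using assms by linarith
  then show ?thesis
  proof cases
    case 1
    define m where "m = N - 6"
    have N: "N = m + 6" using assms by (simp add: m_def)
    have "2 * (N choose 2) = N * (N - 1)"
      by (simp only: choose_two) (simp add: algebra_simps)
    also have "\<dots> \<ge> 2 * (3 * N - 4)" unfolding N by (simp add: algebra_simps)
    finally show ?thesis using 1 by simp
  next
    case 2
    define m where "m = N - 6"
    have N: "N = m + 6" using assms by (simp add: m_def)
    have "2 * ((N - 1) choose 2) = (N - 1) * (N - 1 - 1)"
      by (simp only: choose_two) (simp add: algebra_simps)
    also have "\<dots> \<ge> 4 * N - 5" unfolding N by (simp add: algebra_simps)
    finally show ?thesis using 2 by simp
  next
    case 3
    have "N \<le> N choose d" using assms by (intro choose_ge_self) auto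
    moreover have "N - 1 \<le> (N - 1) choose (d - 1)" using assms by (intro choose_ge_self) auto
    then have "3 * (N - 1) \<le> (d - 1) * ((N - 1) choose (d - 1))"
      using 3 by (intro mult_le_mono) auto
    ultimately show ?thesis by linarith
  qed
qed

lemma bij_betw_extend_point:
  assumes "bij_betw f A B" "a \<notin> A" "b \<notin> B"
  shows "bij_betw (f(a := b)) (insert a A) (insert b B)"
  using assms by (auto simp: bij_betw_def inj_on_def fun_upd_def image_iff)

lemma matching_bijI: "matching n X \<beta>" if "bij_betw \<beta> X Y" "X \<subseteq> {1..n}" "Y \<subseteq> {1..n}" "X \<inter> Y = {}"
  using that by (auto simp: matching_def bij_betw_def)

lemma splits_disjoint_sets:
  assumes "bij_betw \<beta> X Y" "X \<inter> A = {}"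
  shows "splits X \<beta> A \<longleftrightarrow> Y \<subseteq> A"
  using assms by (auto simp: bij_betw_def splits_def)

context symmetric_functions
begin

text \<open>For \<open>d\<close> pairs the translates are images of the polytabloids of the Specht module of \<open>(n - d, d)\<close>, whose
  dimension is of quadratic order already for \<open>d = 2\<close>. A triangular family that is modelled on a part
  of its standard basis suffices. Fix a set \<open>Z\<close> of \<open>k - d\<close>
  points that belong to every evaluation point \<open>Y \<union> Z\<close>, let \<open>X = {1..d}\<close>, and let \<open>R\<close> be the rest.
  There are two families of \<open>d\<close>-sets \<open>Y\<close>. In the first, \<open>Y\<close> lies in \<open>R\<close> and is matched with \<open>X\<close>: a set
  that avoids \<open>X\<close> splits this matching only if it contains \<open>Y\<close>. In the second, \<open>Y\<close> has exactly one point
  \<open>i\<close> in \<open>X\<close>, other than 1; now \<open>i\<close> is matched with 1, and a point \<open>w\<close> of \<open>R\<close> takes the place of \<open>i\<close>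
  among the points to be avoided. Since no evaluation point contains 1, splitting forces \<open>i\<close> into the
  set, and then all of \<open>Y\<close>. So the evaluation matrix is triangular with respect to the number of
  points in \<open>X\<close>.\<close>

lemma alternating_two_pairs_dimension:
  assumes n: "10 \<le> n" "2 * k < n" and T: "finite T" "S \<subseteq> fn.span T"
    and M: "matching n X0 \<beta>0" "2 \<le> card X0" and h: "h \<in> S" "alternating X0 \<beta>0 h"
  shows "2 * n - 3 \<le> card T"
proof -
  obtain d where d': "card X0 \<le> d" "d \<le> k" and full: "\<And>X \<beta>. matching n X \<beta> \<Longrightarrow> card X = d \<Longrightarrow>
      \<exists>u\<in>S. \<forall>A. u A \<noteq> 0 \<longleftrightarrow> A \<in> ksets n k \<and> splits X \<beta> A"
    by (rule full_matching_functions[OF M(1) h]) (rule that)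
  have d: "2 \<le> d" "d \<le> k" using d' M(2) by auto
  define N where "N = n - k"
  define X Z R w where "X = {1..d}" and "Z = {N + d + 1..n}" and "R = {d + 1..N + d}" and "w = d + 1"
  have N: "6 \<le> N" "d < N" "2 * n - 3 \<le> 4 * N - 5" "N + d \<le> n" using n d by (auto simp: N_def)
  have sub: "X \<subseteq> {1..n}" "Z \<subseteq> {1..n}" "R \<subseteq> {1..n}" "w \<in> R"
    using N by (auto simp: X_def Z_def R_def w_def)
  have disj: "X \<inter> Z = {}" "X \<inter> R = {}" "R \<inter> Z = {}"
    using N by (auto simp: X_def Z_def R_def)
  have card: "card X = d" "card Z = k - d" "card R = N"
    using d n by (auto simp: X_def Z_def R_def N_def)
  have fin: "finite X" "finite Z" "finite R" by (auto simp: X_def Z_def R_def)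
  \<comment> \<open>the two families: \<open>Y\<close> disjoint from \<open>X\<close>, and \<open>Y\<close> with one point in \<open>X\<close>\<close>
  define I1 where "I1 = {Y. Y \<subseteq> R \<and> card Y = d}"
  define J where "J = {2..d} \<times> {Y. Y \<subseteq> R - {w} \<and> card Y = d - 1}"
  define I2 where "I2 = (\<lambda>(i, Y). insert i Y) ` J"
  have I1: "Y \<subseteq> R" "card Y = d" "Y \<inter> X = {}" if "Y \<in> I1" for Y
    using that disj by (auto simp: I1_def)
  have I2: "\<exists>i Y1. Y = insert i Y1 \<and> i \<in> X \<and> i \<noteq> 1 \<and> Y1 \<subseteq> R - {w} \<and> card Y1 = d - 1 \<and> Y \<inter> X = {i} \<and> card Y = d"
    if "Y \<in> I2" for Y
  proof -
    obtain i Y1 where Y: "Y = insert i Y1" "i \<in> {2..d}" "Y1 \<subseteq> R - {w}" "card Y1 = d - 1"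
      using \<open>Y \<in> I2\<close> by (auto simp: I2_def J_def)
    have "i \<in> X" using Y(2) by (auto simp: X_def)
    moreover have "Y \<inter> X = {i}" using Y \<open>i \<in> X\<close> disj by auto
    moreover have "card Y = d"
    proof -
      have "finite Y1" "i \<notin> Y1" using Y(3) \<open>i \<in> X\<close> fin(3) disj finite_subset by blast+
      then show ?thesis using Y(1,4) d by simp
    qed
    ultimately show ?thesis using Y by auto
  qed
  have I: "Y \<union> Z \<in> ksets n k" "Y \<inter> Z = {}" "finite Y" "card Y = d" "Y \<subseteq> {1..n}" if "Y \<in> I1 \<union> I2" for Y
  proof -
    have Y: "Y \<subseteq> X \<union> R \<and> card Y = d"
    proof (cases "Y \<in> I1")
      case True
      then show ?thesis using I1[of Y] by blast
    next
      case False
      then have "Y \<in> I2" using that by blast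
      from I2[OF this] show ?thesis by auto
    qed
    then show "card Y = d" by blast
    show "Y \<inter> Z = {}" using Y disj by blast
    show "finite Y" using Y fin by (meson finite_UnI finite_subset)
    show "Y \<subseteq> {1..n}" using Y sub by blast
    with Y \<open>finite Y\<close> \<open>Y \<inter> Z = {}\<close> show "Y \<union> Z \<in> ksets n k"
      using sub d fin by (simp add: ksets_def card_Un_disjoint card)
  qed
  have sep: "\<exists>u\<in>S. u (Y \<union> Z) \<noteq> 0 \<and>
      (\<forall>Y'\<in>I1 \<union> I2. Y' \<noteq> Y \<longrightarrow> u (Y' \<union> Z) \<noteq> 0 \<longrightarrow> card (Y \<inter> X) < card (Y' \<inter> X))"
    if Y: "Y \<in> I1 \<union> I2" for Y
  proof -
    have eqI: "Y' = Y" if "Y' \<in> I1 \<union> I2" "Y \<subseteq> Y' \<union> Z" for Y'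
    proof -
      have "Y \<subseteq> Y'" using that(2) I(2)[OF Y] by blast
      from card_subset_eq[OF I(3)[OF that(1)] this] show ?thesis
        using I(4)[OF Y] I(4)[OF that(1)] by simp
    qed
    show ?thesis
    proof (cases "Y \<in> I1")
      case True
      obtain \<beta> where \<beta>: "bij_betw \<beta> X Y"
        using finite_same_card_bij[OF fin(1) I(3)[OF Y]] I(4)[OF Y] card(1) by auto
      have "X \<inter> Y = {}" using I1(3)[OF True] by blast
      then have "matching n X \<beta>" using matching_bijI[OF \<beta> sub(1) I(5)[OF Y]] by blast
      then obtain u where u: "u \<in> S" "\<And>A. u A \<noteq> 0 \<longleftrightarrow> A \<in> ksets n k \<and> splits X \<beta> A"
        using full card(1) by blast
      have "X \<inter> (Y \<union> Z) = {}" using I1(3)[OF True] disj by blast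
      then have "splits X \<beta> (Y \<union> Z)"
        using splits_disjoint_sets[OF \<beta>] by simp
      then have "u (Y \<union> Z) \<noteq> 0" using u(2) I(1)[OF Y] by simp
      moreover have "card (Y \<inter> X) < card (Y' \<inter> X)"
        if Y': "Y' \<in> I1 \<union> I2" "Y' \<noteq> Y" "u (Y' \<union> Z) \<noteq> 0" for Y'
      proof (rule ccontr)
        assume "\<not> card (Y \<inter> X) < card (Y' \<inter> X)"
        then have "Y' \<inter> X = {}" using I1(3)[OF True] fin by simp
        then have "X \<inter> (Y' \<union> Z) = {}" using disj by blast
        moreover have "splits X \<beta> (Y' \<union> Z)" using u(2) Y'(3) by simp
        ultimately have "Y \<subseteq> Y' \<union> Z" using splits_disjoint_sets[OF \<beta>] by simp
        then show False using eqI[OF Y'(1)] Y'(2) by simp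
      qed
      ultimately show ?thesis using u(1) by blast
    next
      case False
      then obtain i Y1 where Y1: "Y = insert i Y1" "i \<in> X" "i \<noteq> 1" "Y1 \<subseteq> R - {w}" "card Y1 = d - 1" "Y \<inter> X = {i}"
        using I2[of Y] Y by blast
      \<comment> \<open>the points to be avoided, except for 1, which is matched with \<open>i\<close>\<close>
      define X' where "X' = insert w (X - {1, i})"
      have one: "1 \<in> X" using d by (simp add: X_def)
      have w: "w \<notin> X" "w \<notin> Z" using sub disj by blast+
      have "finite Y1" using Y1(4) fin finite_subset by blast
      moreover have "card X' = d - 1"
        using Y1 one w fin card d by (simp add: X'_def card_Diff_subset)
      ultimately obtain \<beta>' where "bij_betw \<beta>' X' Y1"
        using finite_same_card_bij[of X' Y1] Y1 fin by (auto simp: X'_def)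
      moreover have 1: "1 \<notin> X'" "i \<notin> X'" "i \<notin> Y1" using Y1 w one disj by (auto simp: X'_def)
      ultimately have \<beta>: "bij_betw (\<beta>'(1 := i)) (insert 1 X') Y" (is "bij_betw ?\<beta> ?X Y")
        unfolding Y1(1) by (intro bij_betw_extend_point)
      have X'Y: "?X \<inter> (Y \<union> Z) = {}"
        using Y1 w disj one by (auto simp: X'_def)
      have "?X \<subseteq> {1..n}" using sub one by (auto simp: X'_def)
      moreover have "?X \<inter> Y = {}" using X'Y by blast
      ultimately have "matching n ?X ?\<beta>" using matching_bijI[OF \<beta> _ I(5)[OF Y]] by blast
      moreover have "card ?X = d" using bij_betw_same_card[OF \<beta>] I(4)[OF Y] by simp
      ultimately obtain u where u: "u \<in> S" "\<And>A. u A \<noteq> 0 \<longleftrightarrow> A \<in> ksets n k \<and> splits ?X ?\<beta> A"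
        using full by blast
      have "splits ?X ?\<beta> (Y \<union> Z)" using splits_disjoint_sets[OF \<beta> X'Y] by simp
      then have "u (Y \<union> Z) \<noteq> 0" using u(2) I(1)[OF Y] by simp
      moreover have "card (Y \<inter> X) < card (Y' \<inter> X)"
        if Y': "Y' \<in> I1 \<union> I2" "Y' \<noteq> Y" "u (Y' \<union> Z) \<noteq> 0" for Y'
      proof -
        have sp: "splits ?X ?\<beta> (Y' \<union> Z)" using u(2) Y'(3) by simp
        have "1 \<notin> Y'"
        proof (cases "Y' \<in> I1")
          case False
          then have "Y' \<in> I2" using Y'(1) by blast
          from I2[OF this] obtain j where "j \<noteq> 1" "Y' \<inter> X = {j}" by blast
          moreover have "1 \<in> Y' \<Longrightarrow> 1 \<in> Y' \<inter> X" using one by simp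
          ultimately show ?thesis by auto
        qed (use I1(3)[of Y'] one in blast)
        then have "1 \<notin> Y' \<union> Z" using one disj by blast
        then have "i \<in> Y' \<union> Z" using sp by (simp add: splits_def)
        then have "i \<in> Y'" using Y1(2) disj by blast
        then have "Y' \<in> I2" using Y'(1) I1(3)[of Y'] Y1(2) by blast
        from I2[OF this] obtain i' Y1' where i': "Y' = insert i' Y1'" "i' \<in> X" "Y1' \<subseteq> R - {w}" "Y' \<inter> X = {i'}"
          by blast
        have "i \<in> Y' \<inter> X" using \<open>i \<in> Y'\<close> Y1(2) by simp
        then have "i' = i" using i'(4) by simp
        with i' have "?X \<inter> (Y' \<union> Z) = {}"
          using Y1(2) w disj one \<open>1 \<notin> Y' \<union> Z\<close> by (auto simp: X'_def)
        then have "Y \<subseteq> Y' \<union> Z" using sp splits_disjoint_sets[OF \<beta>] by simp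
        then show ?thesis using eqI[OF Y'(1)] Y'(2) by simp
      qed
      ultimately show ?thesis using u(1) by blast
    qed
  qed
  then obtain u where u: "\<And>Y. Y \<in> I1 \<union> I2 \<Longrightarrow> u Y \<in> S \<and> u Y (Y \<union> Z) \<noteq> 0 \<and>
      (\<forall>Y'\<in>I1 \<union> I2. Y' \<noteq> Y \<longrightarrow> u Y (Y' \<union> Z) \<noteq> 0 \<longrightarrow> card (Y \<inter> X) < card (Y' \<inter> X))"
    by metis
  have finI: "finite I1" "finite J"
    using fin by (auto simp: I1_def J_def)
  have "card (I1 \<union> I2) \<le> card T"
  proof (rule triangular_family_card_le[where u = u and p = "\<lambda>Y. Y \<union> Z" and r = "\<lambda>Y. card (Y \<inter> X)"])
    show "finite (I1 \<union> I2)" using finI by (simp add: I2_def)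
    show "u Y \<in> fn.span T" if "Y \<in> I1 \<union> I2" for Y using u[OF that] T(2) by blast
    show "u Y (Y \<union> Z) \<noteq> 0" if "Y \<in> I1 \<union> I2" for Y using u[OF that] by blast
    show "card (Y \<inter> X) < card (Y' \<inter> X)"
      if "Y \<in> I1 \<union> I2" "Y' \<in> I1 \<union> I2" "Y \<noteq> Y'" "u Y (Y' \<union> Z) \<noteq> 0" for Y Y'
      using u[OF that(1)] that(2-4) by metis
  qed (rule T(1))
  moreover have "card (I1 \<union> I2) = card I1 + card I2"
  proof (rule card_Un_disjoint)
    show "I1 \<inter> I2 = {}"
    proof (rule equals0I)
      fix Y assume "Y \<in> I1 \<inter> I2"
      then have "Y \<inter> X = {}" "Y \<in> I2" using I1(3)[of Y] by auto
      then show False using I2[of Y] by auto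
    qed
  qed (simp_all add: finI I2_def)
  moreover have "card I1 = N choose d"
    using n_subsets[OF fin(3), of d] by (simp add: I1_def card)
  moreover have "card I2 = card J"
  proof -
    have "inj_on (\<lambda>(i, Y). insert i Y) J"
    proof (rule inj_onI, clarify)
      fix i Y i' Y' assume J: "(i, Y) \<in> J" "(i', Y') \<in> J" and eq: "insert i Y = insert i' Y'"
      have X: "insert i Y \<inter> X = {i} \<and> insert i Y - X = Y" if "(i, Y) \<in> J" for i Y
      proof -
        have "i \<in> {2..d}" "Y \<subseteq> R" using that unfolding J_def by blast+
        then show ?thesis using disj(2) unfolding X_def by auto
      qed
      have "{i} = {i'}" using X[OF J(1)] X[OF J(2)] unfolding eq by simp
      moreover have "Y = Y'" using X[OF J(1)] X[OF J(2)] unfolding eq by simp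
      ultimately show "i = i' \<and> Y = Y'" by simp
    qed
    then show ?thesis by (simp add: I2_def card_image)
  qed
  moreover have "card J = (d - 1) * ((N - 1) choose (d - 1))"
  proof -
    have "card (R - {w}) = N - 1" using card(3) sub(4) fin(3) by simp
    then show ?thesis
      using n_subsets[of "R - {w}" "d - 1"] fin(3)
      by (simp add: J_def card_cartesian_product)
  qed
  ultimately show ?thesis
    using two_row_count_ge[OF N(1) d(1) N(2)] N(3) by linarith
qed

end

section \<open>Invariant spaces of functions for the alternating group\<close>

text \<open>The value 0 at sets that are not k-subsets is a convention shared by all the spaces of functions
  considered here.\<close>

definition coord :: "nat \<Rightarrow> nat \<Rightarrow> nat \<Rightarrow> nat set \<Rightarrow> 'f::field"
  where "coord n k a = (\<lambda>A. of_bool (A \<in> ksets n k \<and> a \<in> A))"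

lemma coord_image: "coord n k (g a) (g ` A) = coord n k a A" if "g permutes {1..n}"
  by (simp add: coord_def ksets_image_iff[OF that] inj_image_mem_iff[OF permutes_inj[OF that]])

lemma coord_transpose:
  assumes "x \<in> {1..n}" "y \<in> {1..n}"
  shows "(coord n k z (transpose x y ` A) :: 'f::field) =
    coord n k (if z = x then y else if z = y then x else z) A"
proof -
  have "(coord n k (transpose x y (transpose x y z)) (transpose x y ` A) :: 'f) = coord n k (transpose x y z) A"
    by (rule coord_image[OF permutes_swap_id[OF assms]])
  then show ?thesis by (simp add: Transposition.transpose_def[of x y z] split: if_splits)
qed

lemma exists_small_set_avoiding:
  assumes "k + card E \<le> n" "finite E" "i \<notin> E"
  obtains C where "i \<notin> C" "C \<inter> E = {}" "C \<subseteq> {1..n}" "card C = k - 1" "finite C"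
proof -
  have "card ({1..n} - insert i E) \<ge> n - card (insert i E)"
    using diff_card_le_card_Diff[of "insert i E" "{1..n}"] assms by simp
  also have "n - card (insert i E) = n - Suc (card E)"
    using assms by simp
  finally have "k - 1 \<le> card ({1..n} - insert i E)" using assms by linarith
  then obtain C where "C \<subseteq> {1..n} - insert i E" "card C = k - 1" "finite C"
    by (rule obtain_subset_with_card_n)
  then show ?thesis using that[of C] by blast
qed

locale even_invariant_functions =
  fixes n k :: nat and U :: "(nat set \<Rightarrow> 'f::field) set"
  assumes n: "10 \<le> n" and k: "1 \<le> k" "2 * k < n"
    and subspace: "fn.subspace U"
    and support: "\<And>u A. u \<in> U \<Longrightarrow> u A \<noteq> 0 \<Longrightarrow> A \<in> ksets n k"
    and shift_closed: "\<And>g u. g permutes {1..n} \<Longrightarrow> evenperm g \<Longrightarrow> u \<in> U \<Longrightarrow> shift g u \<in> U"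
begin

abbreviation D :: "nat \<Rightarrow> nat \<Rightarrow> nat set \<Rightarrow> 'f"
  where "D a b \<equiv> coord n k a - coord n k b"

text \<open>A rigid function is killed by \<open>(1 - s) (1 - t)\<close> for all disjoint transpositions \<open>s\<close> and \<open>t\<close>:
  in the language of alternating functions, it does not lead beyond a single pair. These are the
  affine functions of the coordinates.\<close>

abbreviation rigid :: "(nat set \<Rightarrow> 'f) \<Rightarrow> bool"
  where "rigid f \<equiv> \<forall>a b c e. {a, b, c, e} \<subseteq> {1..n} \<longrightarrow> a \<noteq> b \<longrightarrow> c \<noteq> e \<longrightarrow> {c, e} \<inter> {a, b} = {} \<longrightarrow>
    shift (transpose c e) (f - shift (transpose a b) f) = f - shift (transpose a b) f"

text \<open>The difference changes sign under the transposition of \<^term>\<open>a\<close> and \<^term>\<open>b\<close>, and rigidity makes it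
  invariant under all transpositions of other points. So it is determined by its value at one set that
  contains \<^term>\<open>a\<close> but not \<^term>\<open>b\<close>, exactly like a multiple of \<^term>\<open>D a b\<close>.\<close>

lemma rigid_difference:
  assumes f: "f \<in> U" "rigid f" and ab: "a \<in> {1..n}" "b \<in> {1..n}" "a \<noteq> b"
  obtains c where "f - shift (transpose a b) f = pscale c (D a b)"
proof -
  let ?h = "f - shift (transpose a b) f"
  obtain C where C: "a \<notin> C" "b \<notin> C" "C \<subseteq> {1..n}" "card C = k - 1" "finite C"
    using exists_small_set_avoiding[of k "{b}" n a] ab k by auto
  define A0 where "A0 = insert a C"
  have A0: "A0 \<in> ksets n k" "a \<in> A0" "b \<notin> A0"
    using C ab k by (auto simp: A0_def ksets_def)
  have perm: "transpose a b permutes {1..n}" using ab by (intro permutes_swap_id)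
  have M: "matching n {a} (\<lambda>_. b)" using ab by (auto simp: matching_def)
  have "?h A = ?h A0 * D a b A" for A
  proof (cases "A \<in> ksets n k")
    case False
    then have "f A = 0" "f (transpose a b ` A) = 0"
      using support[OF f(1)] ksets_image_iff[OF perm] by blast+
    then show ?thesis using False by (simp add: shift_def coord_def)
  next
    case True
    show ?thesis
    proof (cases "a \<in> A \<longleftrightarrow> b \<notin> A")
      case False
      then show ?thesis using transpose_image_fixed[of a A b] by (auto simp: shift_def coord_def)
    next
      case split: True
      show ?thesis
      proof (rule splits_connected[OF M, where A = A0 and P = "\<lambda>A. ?h A = ?h A0 * D a b A"])
        show "?h A0 = ?h A0 * D a b A0" using A0 by (simp add: coord_def)
        show "?h (transpose x y ` B) = ?h A0 * D a b (transpose x y ` B)"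
          if "B \<in> ksets n k" "?h B = ?h A0 * D a b B" "x \<in> {1..n} - ({a} \<union> (\<lambda>_. b) ` {a})"
            "y \<in> {1..n} - ({a} \<union> (\<lambda>_. b) ` {a})" "x \<noteq> y" for B x y
        proof -
          have "shift (transpose x y) ?h = ?h"
            using f(2) that ab by auto
          then have "?h (transpose x y ` B) = ?h B" by (metis shift_def)
          moreover have "D a b (transpose x y ` B) = D a b B"
            using that(3,4) by (simp add: coord_transpose)
          ultimately show ?thesis using that(2) by simp
        qed
        show "?h (transpose x b ` B) = ?h A0 * D a b (transpose x b ` B)"
          if "B \<in> ksets n k" "?h B = ?h A0 * D a b B" "x \<in> {a}" for B x
        proof -
          have "?h (transpose a b ` B) = - ?h B" by (simp add: shift_def)
          also have "\<dots> = - (?h A0 * D a b B)" by (simp only: that(2))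
          also have "\<dots> = ?h A0 * D a b (transpose a b ` B)"
            using ab by (simp add: coord_transpose algebra_simps)
          finally show ?thesis using that(3) by simp
        qed
        show "splits {a} (\<lambda>_. b) A0" using A0(2,3) by (simp add: splits_def)
        show "splits {a} (\<lambda>_. b) A" using split by (simp add: splits_def)
      qed (fact A0(1) True)+
    qed
  qed
  then have "?h = pscale (?h A0) (D a b)" unfolding pscale_def by (rule ext)
  then show ?thesis using that by blast
qed

lemma exists_even_perm:
  assumes "{i, j, l, b} \<subseteq> {1..n}" "i \<noteq> j" "l \<noteq> b"
  obtains g where "g permutes {1..n}" "evenperm g" "g i = l" "g j = b"
proof -
  obtain \<sigma> where \<sigma>: "\<sigma> permutes {1..n}" "\<sigma> ` {i} = {l}" "\<And>x. x \<in> {i} \<Longrightarrow> \<sigma> j = b"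
    using matchings_conjugate[of n "{l}" "\<lambda>_. b" "{i}" "\<lambda>_. j"] assms by (auto simp: matching_def)
  show ?thesis
  proof (cases "evenperm \<sigma>")
    case True
    then show ?thesis using that \<sigma> by blast
  next
    case False
    have "2 \<le> card ({1..n} - {i, j})"
      using diff_card_le_card_Diff[of "{i, j}" "{1..n}"] n assms by (simp add: card_insert_if)
    then obtain R where R: "R \<subseteq> {1..n} - {i, j}" "card R = 2" "finite R"
      by (rule obtain_subset_with_card_n)
    then obtain r q where "R = {r, q}" "r \<noteq> q" by (metis card_2_iff)
    with R(1) have rq: "r \<in> {1..n}" "q \<in> {1..n}" "r \<noteq> q" "r \<noteq> i" "r \<noteq> j" "q \<noteq> i" "q \<noteq> j" by auto
    have perm: "permutation \<sigma>" "permutation (transpose r q)"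
      using permutes_imp_permutation[OF _ \<sigma>(1)] permutation_swap_id by auto
    have "evenperm (\<sigma> \<circ> transpose r q)"
      using evenperm_comp[OF perm] False rq by (simp add: evenperm_swap)
    moreover have "\<sigma> \<circ> transpose r q permutes {1..n}"
      using permutes_compose[OF permutes_swap_id[OF rq(1,2)] \<sigma>(1)] .
    ultimately show ?thesis using that[of "\<sigma> \<circ> transpose r q"] \<sigma> rq by auto
  qed
qed

lemma double_transposition_closed:
  assumes "a \<noteq> b" "c \<noteq> e" "{a, b, c, e} \<subseteq> {1..n}" "u \<in> U"
  shows "shift (transpose a b) (shift (transpose c e) u) \<in> U"
  unfolding shift_shift
proof (rule shift_closed[OF _ _ assms(4)])
  show "transpose c e \<circ> transpose a b permutes {1..n}"
    using assms by (intro permutes_compose permutes_swap_id) auto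
  show "evenperm (transpose c e \<circ> transpose a b)"
    using assms by (subst evenperm_comp) (auto simp: evenperm_swap permutation_swap_id)
qed

text \<open>A single transposition is odd and may leave the space, but a product of two disjoint ones stays in
  it. Let \<open>f\<close> be nonconstant, so that \<open>(1 - (a b)) f = c * D a b\<close> with \<open>c \<noteq> 0\<close> for some \<open>a\<close>, \<open>b\<close>. With
  spare points, \<open>f - (a b) (m m') f = c * D a b + c' * D m m'\<close>, and applying \<open>1 - (b l) (r q)\<close> to this
  removes the unknown second term and leaves \<open>c * D l b\<close>. Seven points are used. Finally, the
  alternating group is transitive on pairs.\<close>

lemma rigid_contains_coordinate_differences:
  assumes rigid: "\<And>f. f \<in> U \<Longrightarrow> rigid f"
    and f: "f \<in> U" "A \<in> ksets n k" "B \<in> ksets n k" "f A \<noteq> f B"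
    and ij: "i \<in> {1..n}" "j \<in> {1..n}" "i \<noteq> j"
  shows "D i j \<in> U"
proof -
  have "\<exists>a b. a \<in> {1..n} \<and> b \<in> {1..n} \<and> a \<noteq> b \<and> shift (transpose a b) f \<noteq> f"
  proof (rule ccontr)
    assume contr: "\<not> ?thesis"
    have inv: "f (transpose a b ` C) = f C" if "a \<in> {1..n}" "b \<in> {1..n}" "a \<noteq> b" for a b C
    proof -
      have "shift (transpose a b) f = f" using contr that by blast
      then show ?thesis unfolding shift_def by (rule fun_cong)
    qed
    have "f B = f A"
      by (rule splits_connected[of n "{}" id A k "\<lambda>B. f B = f A" B])
        (use f in \<open>auto simp: matching_def splits_def inv\<close>)
    with f(4) show False by simp
  qed
  then obtain a b where ab: "a \<in> {1..n}" "b \<in> {1..n}" "a \<noteq> b" "f - shift (transpose a b) f \<noteq> 0"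
    by auto
  have "5 \<le> card ({1..n} - {a, b})"
    using diff_card_le_card_Diff[of "{a, b}" "{1..n}"] n ab by simp
  then obtain P where P: "P \<subseteq> {1..n} - {a, b}" "card P = 5" "finite P"
    by (rule obtain_subset_with_card_n)
  then obtain xs where xs: "set xs = P" "distinct xs" "length xs = 5"
    using finite_distinct_list distinct_card by metis
  then obtain m m' l r q where "xs = [m, m', l, r, q]"
    by (auto simp: length_Suc_conv numeral_eq_Suc)
  with xs P have dist: "distinct [a, b, m, m', l, r, q]" and sub: "{a, b, m, m', l, r, q} \<subseteq> {1..n}"
    using ab by auto
  obtain c where c: "f - shift (transpose a b) f = pscale c (D a b)"
    using rigid_difference[OF f(1) rigid[OF f(1)] ab(1-3)] .
  then have "c \<noteq> 0" using ab(4) by (auto simp: pscale_def fun_eq_iff)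
  obtain c' where c': "f - shift (transpose m m') f = pscale c' (D m m')"
    using rigid_difference[OF f(1) rigid[OF f(1)], of m m'] dist sub by auto
  define v where "v = f - shift (transpose a b) (shift (transpose m m') f)"
  have "v \<in> U"
    unfolding v_def using f(1) dist sub
    by (intro fn.subspace_diff[OF subspace] double_transposition_closed) auto
  have "v = pscale c (D a b) + pscale c' (D m m')"
  proof
    fix A
    have 1: "f A - f (transpose a b ` A) = c * D a b A"
      using fun_cong[OF c, of A] by (simp add: shift_def pscale_def)
    have "D m m' (transpose a b ` A) = D m m' A"
      using ab dist by (auto simp: coord_transpose)
    then have 2: "f (transpose a b ` A) - f (transpose m m' ` transpose a b ` A) = c' * D m m' A"
      using fun_cong[OF c', of "transpose a b ` A"] by (simp add: shift_def pscale_def)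
    have "v A = (f A - f (transpose a b ` A)) + (f (transpose a b ` A) - f (transpose m m' ` transpose a b ` A))"
      by (simp add: v_def shift_def)
    also have "\<dots> = c * D a b A + c' * D m m' A" by (simp only: 1 2)
    finally show "v A = (pscale c (D a b) + pscale c' (D m m')) A" by (simp add: pscale_def)
  qed
  then have v: "v A = c * D a b A + c' * D m m' A" for A by (simp add: pscale_def)
  have "v - shift (transpose b l) (shift (transpose r q) v) = pscale c (D l b)"
  proof
    fix A
    have rq: "D a b (transpose r q ` C) = D a b C" "D m m' (transpose r q ` C) = D m m' C" for C
      using dist sub by (auto simp: coord_transpose)
    have bl: "D a b (transpose b l ` A) = D a l A" "D m m' (transpose b l ` A) = D m m' A"
      using dist sub by (auto simp: coord_transpose)
    have "v (transpose r q ` transpose b l ` A) = c * D a l A + c' * D m m' A"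
      by (simp only: v rq bl)
    then have "(v - shift (transpose b l) (shift (transpose r q) v)) A =
        (c * D a b A + c' * D m m' A) - (c * D a l A + c' * D m m' A)"
      by (simp add: shift_def v)
    also have "\<dots> = pscale c (D l b) A" by (simp add: pscale_def algebra_simps)
    finally show "(v - shift (transpose b l) (shift (transpose r q) v)) A = pscale c (D l b) A" .
  qed
  moreover have "v - shift (transpose b l) (shift (transpose r q) v) \<in> U"
    using \<open>v \<in> U\<close> dist sub
    by (intro fn.subspace_diff[OF subspace] double_transposition_closed) auto
  ultimately have "pscale c (D l b) \<in> U" by simp
  then have "pscale (inverse c) (pscale c (D l b)) \<in> U"
    by (rule fn.subspace_scale[OF subspace])
  then have "D l b \<in> U" using \<open>c \<noteq> 0\<close> by simp
  have "{i, j, l, b} \<subseteq> {1..n}" "l \<noteq> b" using ij sub dist by auto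
  then obtain g where g: "g permutes {1..n}" "evenperm g" "g i = l" "g j = b"
    using exists_even_perm[OF _ ij(3)] by blast
  have "shift g (D l b) = D i j"
  proof
    fix A
    have "(coord n k (g z) (g ` A) :: 'f) = coord n k z A" for z
      by (rule coord_image[OF g(1)])
    from this[of i] this[of j] show "shift g (D l b) A = D i j A"
      by (simp add: shift_def g(3,4))
  qed
  then show ?thesis
    using shift_closed[OF g(1,2) \<open>D l b \<in> U\<close>] by (rule subst[where P = "\<lambda>u. u \<in> U"])
qed

text \<open>Compare the values at two k-subsets that avoid \<^term>\<open>n\<close> and differ by an exchange of \<^term>\<open>i\<close>
  and \<^term>\<open>j\<close>.\<close>

lemma coordinate_differences_vanishing_combination:
  assumes sum: "\<And>A. (\<Sum>i\<in>{1..n - 1}. c i * D i n A) = (0::'f)"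
    and ij: "i \<in> {1..n - 1}" "j \<in> {1..n - 1}"
  shows "c i = c j"
proof (cases "i = j")
  case False
  have "card {j, n} \<le> 2" by (simp add: card_insert_if)
  then have "k + card {j, n} \<le> n" using n k by linarith
  moreover have "i \<notin> {j, n}" using ij False n by auto
  ultimately obtain C where C: "i \<notin> C" "C \<inter> {j, n} = {}" "C \<subseteq> {1..n}" "card C = k - 1" "finite C"
    using exists_small_set_avoiding[of k "{j, n}" n i] by blast
  then have "n \<notin> C" by blast
  have "(\<Sum>l\<in>{1..n - 1}. c l * of_bool (l \<in> C)) + c x = 0"
    if "x \<in> {i, j}" for x
  proof -
    have x: "x \<in> {1..n - 1}" "x \<notin> C" "x \<noteq> n" "x \<in> {1..n}" using that ij C n by auto
    have "insert x C \<in> ksets n k" using C x k by (auto simp: ksets_def)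
    then have D: "D l n (insert x C) = of_bool (l \<in> C) + of_bool (l = x)" for l
      using x \<open>n \<notin> C\<close> by (auto simp: coord_def)
    have "(\<Sum>l\<in>{1..n - 1}. c l * D l n (insert x C)) =
        (\<Sum>l\<in>{1..n - 1}. c l * of_bool (l \<in> C)) + (\<Sum>l\<in>{1..n - 1}. if l = x then c l else 0)"
      unfolding D sum.distrib[symmetric] by (intro sum.cong) (auto simp: algebra_simps)
    also have "(\<Sum>l\<in>{1..n - 1}. if l = x then c l else 0) = c x"
      using x by simp
    finally show ?thesis using sum by simp
  qed
  from this[of i] this[of j] show ?thesis by (metis add_left_cancel insertI1 insertI2)
qed simp

text \<open>In a vanishing combination of the functions \<^term>\<open>D i n\<close> all coefficients are equal to some \<open>c\<close>.
  For \<open>n - 2\<close> of the functions the omitted one has coefficient 0, hence \<open>c = 0\<close>. For all \<open>n - 1\<close> of them,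
  evaluation at a k-subset without \<^term>\<open>n\<close> gives \<open>c * k = 0\<close>, and at one with \<^term>\<open>n\<close> it gives
  \<open>c * (k - n) = 0\<close>; so there is a relation only if the characteristic divides both numbers.\<close>

lemma coordinate_differences_dimension:
  assumes T: "finite T" "U \<subseteq> fn.span T" and D: "\<And>i. i \<in> {1..n - 1} \<Longrightarrow> D i n \<in> U"
  shows "n - 2 \<le> card T" and "\<not> (CHAR('f) dvd n \<and> CHAR('f) dvd k) \<Longrightarrow> n - 1 \<le> card T"
proof -
  have "card {1..n - 2} \<le> card T"
  proof (rule independent_family_card_le[where u = "\<lambda>i. D i n"])
    show "D i n \<in> fn.span T" if "i \<in> {1..n - 2}" for i
      using D[of i] T(2) that by auto
    fix c i assume sum: "\<And>A. (\<Sum>i\<in>{1..n - 2}. c i * D i n A) = (0::'f)" and i: "i \<in> {1..n - 2}"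
    \<comment> \<open>a combination of all \<open>n - 1\<close> differences whose last coefficient is 0\<close>
    define c' where "c' i = (if i = n - 1 then 0 else c i)" for i
    have split: "{1..n - 1} = insert (n - 1) {1..n - 2}" using n by auto
    have "n - 1 \<notin> {1..n - 2}" using n by auto
    then have "(\<Sum>i\<in>{1..n - 1}. c' i * D i n A) = c' (n - 1) * D (n - 1) n A + (\<Sum>i\<in>{1..n - 2}. c' i * D i n A)" for A
      unfolding split by (subst sum.insert) auto
    moreover have "(\<Sum>i\<in>{1..n - 2}. c' i * D i n A) = (\<Sum>i\<in>{1..n - 2}. c i * D i n A)" for A
      by (intro sum.cong) (auto simp: c'_def)
    ultimately have "(\<Sum>i\<in>{1..n - 1}. c' i * D i n A) = 0" for A
      by (simp only: sum) (simp add: c'_def)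
    from coordinate_differences_vanishing_combination[OF this, of i "n - 1"]
    have "c' i = c' (n - 1)" using i n by auto
    moreover have "i \<noteq> n - 1" using i n by auto
    ultimately show "c i = 0" by (simp add: c'_def)
  qed (use T in auto)
  then show "n - 2 \<le> card T" by simp
  assume char: "\<not> (CHAR('f) dvd n \<and> CHAR('f) dvd k)"
  have "card {1..n - 1} \<le> card T"
  proof (rule independent_family_card_le[where u = "\<lambda>i. D i n"])
    show "D i n \<in> fn.span T" if "i \<in> {1..n - 1}" for i
      using D[OF that] T(2) by blast
    fix c i assume sum: "\<And>A. (\<Sum>i\<in>{1..n - 1}. c i * D i n A) = (0::'f)" and i: "i \<in> {1..n - 1}"
    have c: "c j = c i" if "j \<in> {1..n - 1}" for j
      using coordinate_differences_vanishing_combination[OF sum that i] .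
    have val: "c i * (\<Sum>j\<in>{1..n - 1}. D j n A) = 0" for A
      using sum[of A] c by (simp add: sum_distrib_left)
    have count: "(\<Sum>j\<in>{1..n - 1}. of_bool (j \<in> A)) = (of_nat (card (A - {n})) :: 'f)" if "A \<subseteq> {1..n}" for A
    proof -
      have "(\<Sum>j\<in>{1..n - 1}. of_bool (j \<in> A)) = (\<Sum>j\<in>A - {n}. 1 :: 'f)"
        using that by (intro sum.mono_neutral_cong_right) auto
      then show ?thesis by simp
    qed
    have Dsum: "(\<Sum>j\<in>{1..n - 1}. D j n A) = of_nat (card (A - {n})) - of_nat (n - 1) * of_bool (n \<in> A)"
      if A: "A \<in> ksets n k" for A
    proof -
      have "(\<Sum>j\<in>{1..n - 1}. D j n A) = (\<Sum>j\<in>{1..n - 1}. of_bool (j \<in> A) - of_bool (n \<in> A))"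
        using A by (intro sum.cong) (auto simp: coord_def)
      also have "\<dots> = of_nat (card (A - {n})) - of_nat (n - 1) * of_bool (n \<in> A)"
        unfolding sum_subtractf count[OF ksetsD(1)[OF A]] by simp
      finally show ?thesis .
    qed
    have A: "{1..k} \<in> ksets n k" "n \<notin> {1..k}" "card ({1..k} - {n}) = k"
      using k by (auto simp: ksets_def)
    have "(\<Sum>j\<in>{1..n - 1}. D j n {1..k}) = of_nat k"
      unfolding Dsum[OF A(1)] A(3) using A(2) by simp
    then have "c i * of_nat k = 0" using val[of "{1..k}"] by (simp only:)
    moreover have B: "{n - k + 1..n} \<in> ksets n k" "n \<in> {n - k + 1..n}" "card ({n - k + 1..n} - {n}) = k - 1"
      using k by (auto simp: ksets_def)
    have "(\<Sum>j\<in>{1..n - 1}. D j n {n - k + 1..n}) = of_nat (k - 1) - of_nat (n - 1)"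
      unfolding Dsum[OF B(1)] B(3) using B(2) by simp
    then have "(\<Sum>j\<in>{1..n - 1}. D j n {n - k + 1..n}) = of_nat k - of_nat n"
      using k n by (simp add: of_nat_diff)
    then have "c i * (of_nat k - of_nat n) = 0" using val[of "{n - k + 1..n}"] by (simp only:)
    ultimately have "c i * of_nat n = 0" by (auto simp: right_diff_distrib)
    with \<open>c i * of_nat k = 0\<close> char show "c i = 0"
      by (auto simp: of_nat_eq_0_iff_char_dvd)
  qed (use T in auto)
  then show "n - 1 \<le> card T" by simp
qed

text \<open>The closure is what makes odd permutations, hence single transpositions, available. It costs at
  most a factor of 2 in the dimension, which is the reason why the count for two alternating pairs has
  to reach almost twice the wanted bound.\<close>

definition symmetric_closure :: "(nat set \<Rightarrow> 'f) set"
  where "symmetric_closure = fn.span {shift g u |g u. g permutes {1..n} \<and> u \<in> U}"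

lemma symmetric_functions_closure: "symmetric_functions n k symmetric_closure"
proof
  let ?G = "{shift g u |g u. g permutes {1..n} \<and> u \<in> U}"
  show "fn.subspace symmetric_closure" by (simp add: symmetric_closure_def fn.subspace_span)
  show "A \<in> ksets n k" if "u \<in> symmetric_closure" "u A \<noteq> 0" for u A
  proof (rule ccontr)
    assume A: "A \<notin> ksets n k"
    have "u A = 0"
      using that(1) unfolding symmetric_closure_def
    proof (induction rule: fn.span_induct_alt)
      case (step c x y)
      then obtain g v where x: "x = shift g v" "g permutes {1..n}" "v \<in> U" by blast
      then have "x A = 0"
        using support[of v "g ` A"] A ksets_image_iff[of g n A k] by (auto simp: shift_def)
      then show ?case using step by (simp add: pscale_def)
    qed simp
    with that(2) show False by simp
  qed
  show "shift g u \<in> symmetric_closure" if g: "g permutes {1..n}" and u: "u \<in> symmetric_closure" for g u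
  proof -
    have "shift g ` ?G \<subseteq> ?G"
      using permutes_compose[OF g] by (fastforce simp: shift_shift)
    then show ?thesis
      using shift_span[OF u[unfolded symmetric_closure_def], of g] fn.span_mono
      unfolding symmetric_closure_def by blast
  qed
qed

lemma symmetric_closure_spanned:
  assumes "finite T" "U = fn.span T"
  obtains T' where "finite T'" "symmetric_closure \<subseteq> fn.span T'" "card T' \<le> 2 * card T"
proof
  define \<tau> where "\<tau> = transpose 1 (2 :: nat)"
  have \<tau>: "\<tau> permutes {1..n}"
    unfolding \<tau>_def by (rule permutes_swap_id) (use n in auto)
  have odd: "\<not> evenperm \<tau>" and perm: "permutation \<tau>" and invol: "\<tau> \<circ> \<tau> = id"
    by (auto simp: \<tau>_def evenperm_swap permutation_swap_id)
  let ?T = "T \<union> shift \<tau> ` T"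
  show "finite ?T" using assms by simp
  show "card ?T \<le> 2 * card T"
    using card_Un_le[of T "shift \<tau> ` T"] card_image_le[OF assms(1), of "shift \<tau>"] by linarith
  have "shift g u \<in> fn.span ?T" if g: "g permutes {1..n}" and u: "u \<in> U" for g u
  proof (cases "evenperm g")
    case True
    then have "shift g u \<in> fn.span T" using shift_closed[OF g _ u] assms by simp
    then show ?thesis using fn.span_mono[of T ?T] by blast
  next
    case False
    have "permutation g" using permutes_imp_permutation[OF _ g] by simp
    then have "evenperm (g \<circ> \<tau>)" using False odd perm by (simp add: evenperm_comp)
    then have "shift (g \<circ> \<tau>) u \<in> fn.span T"
      using shift_closed[OF permutes_compose[OF \<tau> g] _ u] assms by simp
    from shift_span[OF this, of \<tau>] have "shift g u \<in> fn.span (shift \<tau> ` T)"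
      by (simp add: shift_shift comp_assoc invol)
    then show ?thesis using fn.span_mono[of "shift \<tau> ` T" ?T] by blast
  qed
  then show "symmetric_closure \<subseteq> fn.span ?T"
    unfolding symmetric_closure_def by (intro fn.span_minimal) (auto simp: fn.subspace_span)
qed

text \<open>If every function in the space is rigid, then the space contains all differences of coordinates.
  Otherwise, two disjoint transpositions produce a function that alternates on two pairs, but only in
  the closure under the symmetric group; its dimension is at least \<open>2 * n - 3\<close>, and half of this,
  rounded up, is \<open>n - 1\<close>.\<close>

lemma dimension_ge:
  assumes T: "finite T" "U = fn.span T"
    and f: "f \<in> U" "A \<in> ksets n k" "B \<in> ksets n k" "f A \<noteq> f B"
  shows "(if CHAR('f) dvd n \<and> CHAR('f) dvd k then n - 2 else n - 1) \<le> card T"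
proof (cases "\<forall>f\<in>U. rigid f")
  case True
  then have "D i n \<in> U" if "i \<in> {1..n - 1}" for i
    using rigid_contains_coordinate_differences[OF _ f, of i n] that n by auto
  from coordinate_differences_dimension[OF T(1) _ this] T(2) show ?thesis by auto
next
  case False
  then obtain f a b c e where f: "f \<in> U"
    and abce: "{a, b, c, e} \<subseteq> {1..n}" "a \<noteq> b" "c \<noteq> e" "{c, e} \<inter> {a, b} = {}"
    and nonrigid: "shift (transpose c e) (f - shift (transpose a b) f) \<noteq> f - shift (transpose a b) f"
    by blast
  let ?S = symmetric_closure and ?g = "f - shift (transpose a b) f"
  interpret symmetric_functions n k ?S by (rule symmetric_functions_closure)
  have "shift id f \<in> ?S"
    unfolding symmetric_closure_def using f permutes_id by (intro fn.span_base) blast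
  then have fS: "f \<in> ?S" by simp
  have in_n: "a \<in> {1..n}" "b \<in> {1..n}" "c \<in> {1..n}" "e \<in> {1..n}" using abce by auto
  have gS: "?g \<in> ?S"
    using fS in_n by (intro fn.subspace_diff[OF subspace] shift_closed permutes_swap_id) auto
  have nz: "f - shift (transpose a b) f \<noteq> 0" 
  proof
    assume "?g = 0"
    with nonrigid show False by (auto simp: shift_def fun_eq_iff)
  qed
  have "f \<noteq> 0"
  proof
    assume "f = 0"
    then have "f - shift (transpose a b) f = 0" by (simp add: fun_eq_iff shift_def)
    with nz show False by contradiction
  qed
  then have "alternating {} id f" by (simp add: alternating_def splits_def)
  moreover have "matching n {} id" by (simp add: matching_def)
  ultimately have alt1: "alternating {a} (id(a := b)) ?g" and M1: "matching n {a} (id(a := b))"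
    using alternating_extend[of n "{}" id f a b] matching_extend[of n "{}" id a b] nz in_n abce(2) by auto
  have ce: "c \<in> {1..n} - ({a} \<union> (id(a := b)) ` {a})" "e \<in> {1..n} - ({a} \<union> (id(a := b)) ` {a})"
    using in_n abce(4) by auto
  let ?h = "?g - shift (transpose c e) ?g"
  have "alternating {c, a} ((id(a := b))(c := e)) ?h"
    using alternating_extend[OF M1 alt1 ce abce(3) nonrigid] .
  moreover have "matching n {c, a} ((id(a := b))(c := e))"
    using matching_extend[OF M1 ce abce(3)] .
  moreover have "?h \<in> ?S"
    using fn.subspace_diff[OF subspace gS shift_closed[OF permutes_swap_id[OF in_n(3,4)] gS]] .
  moreover have "2 \<le> card {c, a}" using abce(4) by (auto simp: card_insert_if)
  moreover obtain T' where T': "finite T'" "?S \<subseteq> fn.span T'" "card T' \<le> 2 * card T"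
    using symmetric_closure_spanned[OF T] .
  ultimately have "2 * n - 3 \<le> card T'"
    using alternating_two_pairs_dimension[OF n k(2)] by blast
  then show ?thesis using T'(3) by auto
qed

end

section \<open>From representations to spaces of functions\<close>

interpretation seq: vector_space "fun_scale :: 'f::field \<Rightarrow> _"
  by (rule vector_space_fun_scale)

lemma linear_rep_linear:
  assumes rep: "linear_rep (fun_scale :: 'f::field \<Rightarrow> _) V G act \<Omega> \<rho> \<phi>" and g: "g \<in> carrier G"
  shows "\<rho> g ` V = V"
    and "x \<in> V \<Longrightarrow> y \<in> V \<Longrightarrow> \<rho> g (x + y) = \<rho> g x + \<rho> g y"
    and "x \<in> V \<Longrightarrow> \<rho> g (fun_scale c x) = fun_scale c (\<rho> g x)"
proof -
  have "\<rho> g \<in> carrier (general_linear fun_scale V)"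
    using rep g unfolding linear_rep_def by (blast intro: hom_in_carrier)
  then show "\<rho> g ` V = V"
    "x \<in> V \<Longrightarrow> y \<in> V \<Longrightarrow> \<rho> g (x + y) = \<rho> g x + \<rho> g y"
    "x \<in> V \<Longrightarrow> \<rho> g (fun_scale c x) = fun_scale c (\<rho> g x)"
    by (simp_all add: general_linear_def BijGroup_def Bij_def bij_betw_def)
qed

lemma linear_rep_sum:
  fixes c :: "(nat \<Rightarrow> 'f::field) \<Rightarrow> 'f"
  assumes rep: "linear_rep fun_scale V G act \<Omega> \<rho> \<phi>" and g: "g \<in> carrier G"
    and B: "finite B" "B \<subseteq> V"
  shows "\<rho> g (\<Sum>b\<in>B. fun_scale (c b) b) = (\<Sum>b\<in>B. fun_scale (c b) (\<rho> g b))"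
  using B
proof (induction B rule: finite_induct)
  case empty
  have V: "seq.subspace V" using rep by (simp add: linear_rep_def)
  have "\<rho> g (fun_scale 0 0) = fun_scale 0 (\<rho> g 0)"
    using linear_rep_linear(3)[OF rep g] seq.subspace_0[OF V] by blast
  then show ?case by (simp only: sum.empty seq.scale_zero_left)
next
  case (insert b B)
  have V: "seq.subspace V" using rep by (simp add: linear_rep_def)
  have "fun_scale (c b) b \<in> V" "(\<Sum>b\<in>B. fun_scale (c b) b) \<in> V"
    using insert.prems by (auto intro!: seq.subspace_scale[OF V] seq.subspace_sum[OF V])
  moreover have "b \<in> V" using insert.prems by simp
  ultimately show ?case
    unfolding sum.insert[OF insert.hyps(1,2)] using insert.IH insert.prems
    by (simp only: linear_rep_linear(2,3)[OF rep g] insert_subset simp_thms)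
qed

text \<open>The coordinates of \<^term>\<open>\<phi> A\<close> with respect to a basis of \<^term>\<open>V\<close> are functions of \<^term>\<open>A\<close>. As the
  group acts linearly, it maps their span to itself; as \<^term>\<open>\<phi>\<close> is injective, they are not all
  constant.\<close>

lemma linear_rep_ksets_edim_ge:
  fixes G :: "(nat \<Rightarrow> nat) monoid" and V :: "(nat \<Rightarrow> 'f::field) set"
  assumes n: "10 \<le> n" and k: "1 \<le> k" "2 * k < n" and G: "G = alt_group n \<or> G = sym_group n"
    and rep: "linear_rep fun_scale V G (\<lambda>g A. g ` A) (ksets n k) \<rho> \<phi>"
  shows "enat (if CHAR('f) dvd n \<and> CHAR('f) dvd k then n - 2 else n - 1) \<le> edim fun_scale V"
proof (cases "\<exists>S. finite S \<and> seq.span S = V")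
  case False
  then have "edim fun_scale V = \<infinity>" unfolding edim_def by (rule if_not_P)
  then show ?thesis by simp
next
  case True
  then have edim: "edim fun_scale V = enat (seq.dim V)" unfolding edim_def by (rule if_P)
  have V: "seq.subspace V" and \<phi>: "\<And>A. A \<in> ksets n k \<Longrightarrow> \<phi> A \<in> V" "inj_on \<phi> (ksets n k)"
    and eqv: "\<And>g A. g \<in> carrier G \<Longrightarrow> A \<in> ksets n k \<Longrightarrow> \<phi> (g ` A) = \<rho> g (\<phi> A)"
    using rep by (auto simp: linear_rep_def)
  obtain S where S: "finite S" "seq.span S = V" using True by blast
  obtain B where B: "B \<subseteq> V" "seq.independent B" "V \<subseteq> seq.span B" "card B = seq.dim V"
    using seq.basis_exists by blast
  have fin: "finite B" using seq.independent_span_bound[OF S(1) B(2)] B(1) S(2) by blast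
  have span: "v \<in> seq.span B \<longleftrightarrow> v \<in> V" for v
    using seq.span_minimal[OF B(1) V] B(3) by blast
  define coeff where "coeff v = seq.representation B v" for v
  have coeff: "(\<Sum>b\<in>B. fun_scale (coeff v b) b) = v" if "v \<in> V" for v
    unfolding coeff_def using seq.sum_representation_eq[OF B(2) _ fin] that span by blast
  define w where "w b = (\<lambda>A. if A \<in> ksets n k then coeff (\<phi> A) b else 0)" for b
  have shift_w: "shift g (w b) = (\<Sum>b'\<in>B. pscale (coeff (\<rho> g b') b) (w b'))"
    if g: "g \<in> carrier G" "g permutes {1..n}" for g b
  proof
    fix A
    show "shift g (w b) A = (\<Sum>b'\<in>B. pscale (coeff (\<rho> g b') b) (w b')) A"
    proof (cases "A \<in> ksets n k")
      case False
      then show ?thesis by (simp add: shift_def w_def ksets_image_iff[OF g(2)] sum_fun_apply pscale_def)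
    next
      case True
      have \<rho>V: "\<rho> g b' \<in> seq.span B" if "b' \<in> B" for b'
        using linear_rep_linear(1)[OF rep g(1)] B(1) that span by blast
      have "\<phi> (g ` A) = \<rho> g (\<Sum>b'\<in>B. fun_scale (coeff (\<phi> A) b') b')"
        using eqv[OF g(1) True] coeff[OF \<phi>(1)[OF True]] by simp
      also have "\<dots> = (\<Sum>b'\<in>B. fun_scale (coeff (\<phi> A) b') (\<rho> g b'))"
        using linear_rep_sum[OF rep g(1) fin B(1)] .
      finally have "coeff (\<phi> (g ` A)) b = coeff (\<Sum>b'\<in>B. fun_scale (coeff (\<phi> A) b') (\<rho> g b')) b"
        by simp
      also have "\<dots> = (\<Sum>b'\<in>B. coeff (fun_scale (coeff (\<phi> A) b') (\<rho> g b')) b)"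
        unfolding coeff_def[of "sum _ _"] coeff_def[of "fun_scale _ (\<rho> g _)"]
        by (subst seq.representation_sum[OF B(2)]) (auto intro: seq.span_scale \<rho>V)
      also have "\<dots> = (\<Sum>b'\<in>B. coeff (\<phi> A) b' * coeff (\<rho> g b') b)"
        by (intro sum.cong refl) (simp add: coeff_def seq.representation_scale[OF B(2) \<rho>V])
      finally show ?thesis
        using True by (simp add: shift_def w_def ksets_image_iff[OF g(2)] sum_fun_apply pscale_def mult.commute)
    qed
  qed
  let ?T = "w ` B"
  interpret even_invariant_functions n k "fn.span ?T"
  proof
    show "fn.subspace (fn.span ?T)" by (rule fn.subspace_span)
    show "A \<in> ksets n k" if "u \<in> fn.span ?T" "u A \<noteq> 0" for u A
    proof (rule ccontr)
      assume A: "A \<notin> ksets n k"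
      have "u A = 0"
        using that(1)
      proof (induction rule: fn.span_induct_alt)
        case (step c x y)
        then show ?case using A by (auto simp: pscale_def w_def)
      qed simp
      with that(2) show False by simp
    qed
    show "shift g u \<in> fn.span ?T" if g: "g permutes {1..n}" "evenperm g" and u: "u \<in> fn.span ?T" for g u
    proof -
      have gG: "g \<in> carrier G" using G g by (auto simp: alt_group_carrier sym_group_carrier)
      have "shift g (w b) \<in> fn.span ?T" for b
        unfolding shift_w[OF gG g(1)] by (intro fn.span_sum fn.span_scale fn.span_base imageI)
      then have "fn.span (shift g ` ?T) \<subseteq> fn.span ?T"
        by (intro fn.span_minimal) (auto simp: fn.subspace_span)
      then show ?thesis using shift_span[OF u] by blast
    qed
  qed (use n k in auto)
  have AB: "{1..k} \<in> ksets n k" "{2..k + 1} \<in> ksets n k" "{1..k} \<noteq> {2..k + 1}"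
    using k by (auto simp: ksets_def)
  have "\<exists>b\<in>B. w b {1..k} \<noteq> w b {2..k + 1}"
  proof (rule ccontr)
    assume "\<not> ?thesis"
    then have "(\<Sum>b\<in>B. fun_scale (coeff (\<phi> {1..k}) b) b) = (\<Sum>b\<in>B. fun_scale (coeff (\<phi> {2..k + 1}) b) b)"
      using AB by (intro sum.cong) (auto simp: w_def)
    then have "\<phi> {1..k} = \<phi> {2..k + 1}"
      by (simp only: coeff[OF \<phi>(1)[OF AB(1)]] coeff[OF \<phi>(1)[OF AB(2)]])
    with inj_onD[OF \<phi>(2) _ AB(1,2)] AB(3) show False by blast
  qed
  then obtain b where "w b \<in> fn.span ?T" "w b {1..k} \<noteq> w b {2..k + 1}"
    by (meson fn.span_base imageI)
  then have "(if CHAR('f) dvd n \<and> CHAR('f) dvd k then n - 2 else n - 1) \<le> card ?T"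
    using dimension_ge[of ?T] fin AB by blast
  also have "card ?T \<le> seq.dim V" using card_image_le[OF fin, of w] B(4) by simp
  finally show ?thesis by (simp add: edim)
qed

section \<open>The representation of least dimension\<close>

text \<open>The quotient of the permutation module by the constant vectors is realised inside the sequences by
  choosing in each class the representative that vanishes at \<^term>\<open>n\<close>. The group then acts by
  permuting the coordinates and passing to the representative again.\<close>

definition mod_constants :: "nat \<Rightarrow> (nat \<Rightarrow> 'f::field) \<Rightarrow> nat \<Rightarrow> 'f"
  where "mod_constants n w = (\<lambda>i. if i \<in> {1..n} then w i - w n else 0)"

text \<open>The flag \<^term>\<open>z\<close> restricts the space to vectors of coordinate sum 0. This is compatible with
  passing to representatives only if the constant vectors have sum 0, that is, if \<^term>\<open>n\<close> is 0 in the
  field.\<close>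

definition natural_space :: "nat \<Rightarrow> bool \<Rightarrow> (nat \<Rightarrow> 'f::field) set"
  where "natural_space n z =
    {w. (\<forall>i. w i \<noteq> 0 \<longrightarrow> i \<in> {1..n - 1}) \<and> (z \<longrightarrow> (\<Sum>i\<in>{1..n}. w i) = 0)}"

lemma natural_space_subspace: "seq.subspace (natural_space n z :: (nat \<Rightarrow> 'f::field) set)"
proof (rule seq.subspaceI)
  fix x y :: "nat \<Rightarrow> 'f" and c
  assume x: "x \<in> natural_space n z"
  show "fun_scale c x \<in> natural_space n z"
    using x by (auto simp: natural_space_def fun_scale_def simp flip: sum_distrib_left)
  assume y: "y \<in> natural_space n z"
  have "x i + y i = 0" if "i \<notin> {1..n - 1}" for i
  proof -
    have "x i = 0" "y i = 0" using x y that unfolding natural_space_def by blast+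
    then show ?thesis by simp
  qed
  then show "x + y \<in> natural_space n z"
    using x y by (auto simp: natural_space_def sum.distrib)
qed (simp add: natural_space_def)

lemma natural_space_edim_le:
  assumes n: "2 \<le> n"
  shows "edim fun_scale (natural_space n z :: (nat \<Rightarrow> 'f::field) set) \<le> enat (if z then n - 2 else n - 1)"
proof -
  let ?V = "natural_space n z :: (nat \<Rightarrow> 'f) set"
  define I where "I = {if z then 2 else 1..n - 1}"
  \<comment> \<open>the basis \<open>e i\<close> of the whole space, or \<open>e i - e 1\<close> with \<open>i \<noteq> 1\<close> of the vectors of sum 0\<close>
  define E :: "nat \<Rightarrow> nat \<Rightarrow> 'f" where
    "E i = (\<lambda>j. of_bool (j = i) - of_bool (z \<and> j = 1))" for i
  have E: "E i \<in> ?V" if "i \<in> I" for i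
  proof -
    have "(\<Sum>j\<in>{1..n}. E i j) = 0" if z
      using that n \<open>i \<in> I\<close> by (auto simp: E_def I_def sum_subtractf of_bool_def)
    then show ?thesis
      using n \<open>i \<in> I\<close> by (auto simp: natural_space_def E_def I_def split: if_splits)
  qed
  have "v \<in> seq.span (E ` I)" if v: "v \<in> ?V" for v
  proof -
    have supp: "v j = 0" if "j \<notin> {1..n - 1}" for j
      using v that unfolding natural_space_def by blast
    have "v = (\<Sum>i\<in>I. fun_scale (v i) (E i))"
    proof
      fix j
      have "(\<Sum>i\<in>I. fun_scale (v i) (E i)) j = (\<Sum>i\<in>I. v i * of_bool (j = i)) - (\<Sum>i\<in>I. v i) * of_bool (z \<and> j = 1)"
        by (simp add: sum_fun_apply fun_scale_def E_def right_diff_distrib sum_subtractf sum_distrib_right)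
      also have "(\<Sum>i\<in>I. v i * of_bool (j = i)) = (if j \<in> I then v j else 0)"
        by (simp add: I_def of_bool_def if_distrib[of "\<lambda>x. _ * x"] cong: if_cong)
      also have "(if j \<in> I then v j else 0) - (\<Sum>i\<in>I. v i) * of_bool (z \<and> j = 1) = v j"
      proof (cases "z \<and> j = 1")
        case True
        have "{1..n} = insert 1 (insert n I)" using True n by (auto simp: I_def)
        moreover have "(\<Sum>i\<in>{1..n}. v i) = 0" using v True by (simp add: natural_space_def)
        moreover have "1 \<notin> I" "n \<notin> I" "v n = 0"
          using True n supp[of n] by (auto simp: I_def)
        ultimately have "v 1 + (\<Sum>i\<in>I. v i) = 0"
          using supp[of 1] by (cases "n = 1") (auto simp: I_def)
        then have "v 1 = - (\<Sum>i\<in>I. v i)" by (simp only: eq_neg_iff_add_eq_0)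
        then show ?thesis using True \<open>1 \<notin> I\<close> by simp
      next
        case False
        then show ?thesis using supp[of j] by (auto simp: I_def)
      qed
      finally show "v j = (\<Sum>i\<in>I. fun_scale (v i) (E i)) j" by simp
    qed
    also have "\<dots> \<in> seq.span (E ` I)"
      by (intro seq.span_sum seq.span_scale seq.span_base) auto
    finally show ?thesis .
  qed
  then have sub: "?V \<subseteq> seq.span (E ` I)" by blast
  moreover have "seq.span (E ` I) \<subseteq> ?V"
    using E by (intro seq.span_minimal natural_space_subspace) auto
  ultimately have "seq.span (E ` I) = ?V" by blast
  moreover have fin: "finite (E ` I)" by (simp add: I_def)
  ultimately have "\<exists>B. finite B \<and> seq.span B = ?V" by blast
  then have edim: "edim fun_scale ?V = enat (seq.dim ?V)" unfolding edim_def by (rule if_P)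
  have "seq.dim ?V \<le> card (E ` I)" using seq.dim_le_card[OF sub fin] .
  also have "\<dots> \<le> card I" by (intro card_image_le) (simp add: I_def)
  also have "\<dots> = (if z then n - 2 else n - 1)" by (auto simp: I_def numeral_2_eq_2)
  finally show ?thesis unfolding edim by simp
qed

definition natural_action :: "nat \<Rightarrow> (nat \<Rightarrow> nat) \<Rightarrow> (nat \<Rightarrow> 'f::field) \<Rightarrow> nat \<Rightarrow> 'f"
  where "natural_action n g w = mod_constants n (w \<circ> inv' g)"

lemma mod_constants_twice:
  assumes "h permutes {1..n}" "1 \<le> n"
  shows "mod_constants n (mod_constants n w \<circ> h) = mod_constants n (w \<circ> h)"
proof
  fix i
  have "h n \<in> {1..n}" using assms permutes_in_image[OF assms(1)] by auto
  moreover have "h i \<in> {1..n}" if "i \<in> {1..n}" using that permutes_in_image[OF assms(1)] by blast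
  ultimately show "mod_constants n (mod_constants n w \<circ> h) i = mod_constants n (w \<circ> h) i"
    by (auto simp: mod_constants_def)
qed

lemma mod_constants_id: "mod_constants n w = w" if "w \<in> natural_space n z" "1 \<le> n"
proof
  fix i
  have supp: "w j = 0" if "j \<notin> {1..n - 1}" for j
    using \<open>w \<in> _\<close> that unfolding natural_space_def by blast
  show "mod_constants n w i = w i"
    using supp[of n] supp[of i] that(2) by (auto simp: mod_constants_def)
qed

lemma mod_constants_in_natural_space:
  fixes w :: "nat \<Rightarrow> 'f::field"
  assumes "z \<Longrightarrow> (of_nat n :: 'f) = 0" "z \<Longrightarrow> (\<Sum>i\<in>{1..n}. w i) = 0"
  shows "mod_constants n w \<in> natural_space n z"
proof -
  have "i \<in> {1..n - 1}" if "mod_constants n w i \<noteq> 0" for i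
  proof -
    have "i \<in> {1..n}" "i \<noteq> n" using that by (auto simp: mod_constants_def split: if_splits)
    then show ?thesis by auto
  qed
  moreover have "(\<Sum>i\<in>{1..n}. mod_constants n w i) = 0" if z
  proof -
    have "(\<Sum>i\<in>{1..n}. mod_constants n w i) = (\<Sum>i\<in>{1..n}. w i - w n)"
      by (intro sum.cong) (auto simp: mod_constants_def)
    then show ?thesis using assms[OF that] by (simp add: sum_subtractf)
  qed
  ultimately show ?thesis unfolding natural_space_def by blast
qed

lemma natural_action_closed:
  fixes w :: "nat \<Rightarrow> 'f::field"
  assumes "z \<Longrightarrow> (of_nat n :: 'f) = 0" "g permutes {1..n}" "w \<in> natural_space n z"
  shows "natural_action n g w \<in> natural_space n z"
proof -
  have "(\<Sum>i\<in>{1..n}. (w \<circ> inv' g) i) = (\<Sum>i\<in>{1..n}. w i)"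
    using sum.permute[OF permutes_inv[OF assms(2)], of w] by simp
  then show ?thesis
    using assms unfolding natural_action_def
    by (intro mod_constants_in_natural_space) (auto simp: natural_space_def)
qed

lemma natural_action_comp:
  assumes "g permutes {1..n}" "h permutes {1..n}" "1 \<le> n"
  shows "natural_action n (g \<circ> h) w = natural_action n g (natural_action n h w)"
  unfolding natural_action_def mod_constants_twice[OF permutes_inv[OF assms(1)] assms(3)]
  by (simp add: o_inv_distrib permutes_bij[OF assms(1)] permutes_bij[OF assms(2)] comp_assoc)

lemma natural_action_inv:
  assumes "g permutes {1..n}" "w \<in> natural_space n z" "1 \<le> n"
  shows "natural_action n (inv' g) (natural_action n g w) = w"
proof -
  have "natural_action n (inv' g) (natural_action n g w) = natural_action n id w"
    using natural_action_comp[OF permutes_inv[OF assms(1)] assms(1,3), of w]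
    by (simp add: permutes_inv_o(2)[OF assms(1)])
  then show ?thesis using mod_constants_id[OF assms(2,3)] by (simp add: natural_action_def)
qed

lemma natural_action_bij:
  fixes z :: bool
  assumes z: "z \<Longrightarrow> (of_nat n :: 'f::field) = 0" and g: "g permutes {1..n}" and n: "1 \<le> n"
  shows "bij_betw (natural_action n g) (natural_space n z :: (nat \<Rightarrow> 'f) set) (natural_space n z)"
proof (rule bij_betw_byWitness[where f' = "natural_action n (inv' g)"])
  let ?V = "natural_space n z :: (nat \<Rightarrow> 'f) set"
  show "\<forall>w\<in>?V. natural_action n (inv' g) (natural_action n g w) = w"
    using natural_action_inv[OF g _ n] by blast
  show "\<forall>w\<in>?V. natural_action n g (natural_action n (inv' g) w) = w"
    using natural_action_inv[OF permutes_inv[OF g] _ n] permutes_inv_inv[OF g] by metis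
  show "natural_action n g ` ?V \<subseteq> ?V" "natural_action n (inv' g) ` ?V \<subseteq> ?V"
    using natural_action_closed[OF z] g permutes_inv[OF g] by blast+
qed

text \<open>A k-subset goes to the class of its indicator vector. Two different k-subsets leave some point
  uncovered as \<open>2 * k < n\<close>, so the difference of their indicators takes the values 0 and 1, and is
  not constant.\<close>

lemma natural_rep:
  fixes z :: bool
  assumes n: "1 \<le> n" and k: "2 * k < n" and G: "G = alt_group n \<or> G = sym_group n"
    and z: "z \<Longrightarrow> (of_nat n :: 'f::field) = 0" "z \<Longrightarrow> (of_nat k :: 'f::field) = 0"
  shows "\<exists>\<rho> \<phi>. linear_rep (fun_scale :: 'f \<Rightarrow> _) (natural_space n z) G (\<lambda>g A. g ` A) (ksets n k) \<rho> \<phi>"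
proof -
  let ?V = "natural_space n z :: (nat \<Rightarrow> 'f) set"
  define \<rho> :: "(nat \<Rightarrow> nat) \<Rightarrow> (nat \<Rightarrow> 'f) \<Rightarrow> nat \<Rightarrow> 'f" where "\<rho> g = restrict (natural_action n g) ?V" for g
  define \<phi> :: "nat set \<Rightarrow> nat \<Rightarrow> 'f" where "\<phi> A = mod_constants n (\<lambda>i. of_bool (i \<in> A))" for A
  have perm: "g permutes {1..n}" if "g \<in> carrier G" for g
    using G that by (auto simp: alt_group_carrier sym_group_carrier)
  have mult: "g \<otimes>\<^bsub>G\<^esub> h = g \<circ> h" for g h
    using G by (auto simp: alt_group_mult sym_group_mult)
  have Bij: "\<rho> g \<in> Bij ?V" if "g \<in> carrier G" for g
    using natural_action_bij[OF z(1) perm[OF that] n] by (simp add: Bij_def \<rho>_def cong: bij_betw_cong)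
  have closed: "natural_action n g w \<in> ?V" if "g \<in> carrier G" "w \<in> ?V" for g w
    using natural_action_closed[OF z(1) perm[OF that(1)] that(2)] .
  have "\<rho> \<in> hom G (general_linear fun_scale ?V)"
  proof (rule homI)
    fix g assume g: "g \<in> carrier G"
    have "natural_action n g (x + y) = natural_action n g x + natural_action n g y"
      "natural_action n g (fun_scale c x) = fun_scale c (natural_action n g x)" for x y :: "nat \<Rightarrow> 'f" and c
      by (auto simp: natural_action_def mod_constants_def fun_scale_def fun_eq_iff algebra_simps)
    moreover have "x + y \<in> ?V" "fun_scale c x \<in> ?V" if "x \<in> ?V" "y \<in> ?V" for x y c
      using that seq.subspace_add[OF natural_space_subspace] seq.subspace_scale[OF natural_space_subspace]
      by blast+
    ultimately show "\<rho> g \<in> carrier (general_linear fun_scale ?V)"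
      using Bij[OF g]
      by (simp add: general_linear_def BijGroup_def \<rho>_def)
  next
    fix g h assume gh: "g \<in> carrier G" "h \<in> carrier G"
    have "\<rho> (g \<otimes>\<^bsub>G\<^esub> h) = compose ?V (\<rho> g) (\<rho> h)"
      unfolding mult \<rho>_def compose_def
      by (rule restrict_ext) (simp add: closed gh natural_action_comp[OF perm[OF gh(1)] perm[OF gh(2)] n])
    then show "\<rho> (g \<otimes>\<^bsub>G\<^esub> h) = \<rho> g \<otimes>\<^bsub>general_linear fun_scale ?V\<^esub> \<rho> h"
      using Bij gh by (simp add: general_linear_def BijGroup_def)
  qed
  moreover have \<phi>V: "\<phi> A \<in> ?V" if A: "A \<in> ksets n k" for A
    unfolding \<phi>_def
  proof (rule mod_constants_in_natural_space)
    assume z': z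
    have "(\<Sum>i\<in>{1..n}. of_bool (i \<in> A)) = (\<Sum>i\<in>A. 1 :: 'f)"
      using ksetsD(1)[OF A] by (intro sum.mono_neutral_cong_right) auto
    then show "(\<Sum>i\<in>{1..n}. of_bool (i \<in> A)) = (0 :: 'f)"
      using z(2)[OF z'] ksetsD(2)[OF A] by simp
  qed (rule z(1))
  moreover have "inj_on \<phi> (ksets n k)"
  proof (rule inj_onI, rule ccontr)
    fix A B assume A: "A \<in> ksets n k" and B: "B \<in> ksets n k" and eq: "\<phi> A = \<phi> B" and "A \<noteq> B"
    have "\<not> A \<subseteq> B"
      using \<open>A \<noteq> B\<close> ksetsD[OF A] ksetsD[OF B] card_subset_eq[of B A] by auto
    then obtain i where i: "i \<in> A" "i \<notin> B" "i \<in> {1..n}" using ksetsD(1)[OF A] by blast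
    have "card (A \<union> B) < card {1..n}"
      using card_Un_le[of A B] ksetsD(2)[OF A] ksetsD(2)[OF B] k by simp
    then have "\<not> {1..n} \<subseteq> A \<union> B"
      using card_mono[of "A \<union> B" "{1..n}"] ksetsD(3)[OF A] ksetsD(3)[OF B] by auto
    then obtain l where l: "l \<in> {1..n}" "l \<notin> A" "l \<notin> B" by blast
    have "of_bool (j \<in> A) - of_bool (n \<in> A) = (of_bool (j \<in> B) - of_bool (n \<in> B) :: 'f)" if "j \<in> {1..n}" for j
      using fun_cong[OF eq, of j] that by (simp add: \<phi>_def mod_constants_def)
    from this[OF i(3)] this[OF l(1)] i l show False by simp
  qed
  moreover have "\<phi> (g ` A) = \<rho> g (\<phi> A)" if g: "g \<in> carrier G" and A: "A \<in> ksets n k" for g A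
  proof -
    have "inv' g i \<in> A \<longleftrightarrow> i \<in> g ` A" for i
      using permutes_bij[OF perm[OF g]] by (metis bij_inv_eq_iff image_iff)
    then have "\<phi> (g ` A) = mod_constants n ((\<lambda>i. of_bool (i \<in> A)) \<circ> inv' g)"
      by (simp add: \<phi>_def comp_def)
    then show ?thesis
      using \<phi>V[OF A]
      by (simp add: \<rho>_def natural_action_def \<phi>_def mod_constants_twice[OF permutes_inv[OF perm[OF g]] n])
  qed
  ultimately have "linear_rep fun_scale ?V G (\<lambda>g A. g ` A) (ksets n k) \<rho> \<phi>"
    unfolding linear_rep_def using natural_space_subspace by auto
  then show ?thesis by blast
qed

theorem theorem1p4:
  fixes n k :: nat and G :: "(nat \<Rightarrow> nat) monoid"
  assumes "n \<ge> 10"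
    and "G = alt_group n \<or> G = sym_group n"
    and "1 \<le> k" and "real k < real n / 2"
  shows "LinDim TYPE('f::field) G (\<lambda>g A. g ` A) {A. A \<subseteq> {1..n} \<and> card A = k} =
    (if CHAR('f) dvd n \<and> CHAR('f) dvd k then enat (n - 2) else enat (n - 1))"
proof -
  define z where "z \<longleftrightarrow> CHAR('f) dvd n \<and> CHAR('f) dvd k"
  have k: "2 * k < n" using assms(4) by linarith
  obtain \<rho> \<phi> where rep: "linear_rep (fun_scale :: 'f \<Rightarrow> _) (natural_space n z) G (\<lambda>g A. g ` A) (ksets n k) \<rho> \<phi>"
    using natural_rep[OF _ k assms(2), where z = z and 'f = 'f] assms(1)
    by (auto simp: z_def of_nat_eq_0_iff_char_dvd)
  have "LinDim TYPE('f) G (\<lambda>g A. g ` A) (ksets n k) = enat (if z then n - 2 else n - 1)"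
  proof (rule antisym)
    show "LinDim TYPE('f) G (\<lambda>g A. g ` A) (ksets n k) \<le> enat (if z then n - 2 else n - 1)"
      using LinDim_le[OF vector_space_fun_scale rep] natural_space_edim_le[of n z, where 'f = 'f] assms(1)
      by auto
    show "enat (if z then n - 2 else n - 1) \<le> LinDim TYPE('f) G (\<lambda>g A. g ` A) (ksets n k)"
      unfolding LinDim_def z_def
      by (rule INF_greatest) (use linear_rep_ksets_edim_ge[OF assms(1,3) k assms(2)] in blast)
  qed
  then show ?thesis by (simp add: ksets_def z_def)
qed

end
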